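(* Consider a discounted MDP, a mirror map $h$, a parameterization class $\mathcal F^\Theta$, and the iterates $(\pi^t)_{t\ge0}$ of AMPO with step-sizes $\eta_t>0$ (all as described in the context). Assume that there are constants $\varepsilon_{\mathrm{approx}}\ge0$ and $C_v\ge0$ such that: (A1) for all $t\ge 0$, $\mathbb E\big[\|f^{t+1}-Q^t-\eta_t^{-1}\nabla h(\pi^t)\|_{L_2(v^t)}^2\big]\le \varepsilon_{\mathrm{approx}}$; (A2) for all $t\geq 0$, $\mathbb E_{(s,a)\sim v^t}\Big[\Big(\frac{d_\mu^\pi(s)\pi(a\mid s)}{v^t(s,a)}\Big)^2\Big]\le C_v$ whenever $(d_\mu^\pi,\pi)$ is one of $(d_\mu^\star,\pi^\star)$, $(d_\mu^{t+1},\pi^{t+1})$, $(d_\mu^\star,\pi^t)$, $(d_\mu^{t+1},\pi^t)$. Then for all $t\ge0$, $$\mathbb E\big[V^{t+1}(\mu)-V^t(\mu)\big]\ge\mathbb E\left[\mathbb E_{s\sim d_\mu^{t+1}}\left[\frac{\mathcal D_h(\pi^{t+1}_s,\pi^t_s)+\mathcal D_h(\pi^t_s,\pi^{t+1}_s)}{\eta_t(1-\gamma)}\right]\right]-\frac{2\sqrt{C_v\varepsilon_{\mathrm{approx}}}}{1-\gamma},$$ where the outer expectation is over the randomness of AMPO.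
   Context: MDP. $(\mathcal S,\mathcal A,P,r,\gamma,\mu)$ is a discounted Markov decision process: $\mathcal S$ a possibly infinite state space, $\mathcal A$ a finite action set, $P(s'\mid s,a)$ transition probabilities, $r(s,a)\in[0,1]$ rewards, $\gamma\in[0,1)$, $\mu$ a distribution on $\mathcal S$. $\Delta(\mathcal A)$ is the probability simplex in $\mathbb R^{|\mathcal A|}$. A policy $\pi$ assigns to each $s$ a vector $\pi_s=[\pi(a\mid s)]_{a\in\mathcal A}\in\Delta(\mathcal A)$. $V^\pi(s)=\mathbb E[\sum_{t\ge0}\gamma^t r(s_t,a_t)\mid \pi,s_0=s]$ and $Q^\pi(s,a)=\mathbb E[\sum_{t\ge0}\gamma^t r(s_t,a_t)\mid\pi, s_0=s,a_0=a]$, with $a_t\sim\pi(\cdot\mid s_t)$, $s_{t+1}\sim P(\cdot\mid s_t,a_t)$; $V^\pi(\mu)=\mathbb E_{s\sim\mu}[V^\pi(s)]$. $\pi^\star$ is a policy maximizing $V^\pi(\mu)$ over all policies. The discounted state visitation distribution is $d_\mu^\pi(s)=(1-\gamma)\mathbb E_{s_0\sim\mu}[\sum_{t\ge0}\gamma^tP(s_t=s\mid\pi,s_0)]$; $d_\mu^\star=d_\mu^{\pi^\star}$. Ratios of distributions are ratios of mass functions (or of densities with respect to a common reference measure), with denominators positive wherever numerators are. Mirror map. $\mathcal Y\subseteq\mathbb R^{|\mathcal A|}$ is convex with $\Delta(\mathcal A)\subseteq\mathcal Y$; $h:\mathcal Y\to\mathbb R$ is strictly convex, continuous on $\mathcal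 Y$, continuously differentiable on $\operatorname{int}\mathcal Y$, essentially smooth ($\|\nabla h(x)\|_2\to+\infty$ as $x\to\partial\mathcal Y$), and $\nabla h(\operatorname{int}\mathcal Y)=\mathbb R^{|\mathcal A|}$. $h^*(x^* )=\sup_{x\in\mathcal Y}\langle x^*,x\rangle-h(x)$ is its conjugate; $\nabla h^*$ is the inverse of $\nabla h$. Bregman divergence: $\mathcal D_h(x,y)=h(x)-h(y)-\langle\nabla h(y),x-y\rangle$. Bregman projection: $\mathrm{Proj}^h_{\Delta(\mathcal A)}(y)=\arg\min_{x\in\Delta(\mathcal A)}\mathcal D_h(x,y)$. AMPO (Approximate Mirror Policy Optimization). $\mathcal F^\Theta=\{f^\theta:\mathcal S\times\mathcal A\to\mathbb R,\ \theta\in\Theta\}$ is any parameterized function class; $f^\theta_s=[f^\theta(s,a)]_{a\in\mathcal A}$. $(v^t)_{t\ge0}$ is a sequence of distributions on $\mathcal S\times\mathcal A$, and $\|y\|_{L_2(v)}^2=\mathbb E_{(s,a)\sim v}[y(s,a)^2]$. Start from an initial policy $\pi^0$ with $\pi^0_s\in\operatorname{int}\mathcal Y$ for all $s$. For $t=0,1,\dots$: (1) obtain, by a possibly randomized procedure, $\theta^{t+1}\in\Theta$ as a solution of $\min_{\theta\in\Theta}\|f^\theta-Q^t-\eta_t^{-1}\nabla h(\pi^t)\|^2_{L_2(v^t)}$, where $\nabla h(\pi^t)(s,a)=[\nabla h(\pi^t_s)]_a$ (the accuracy achieved is quantified by the approximation-error assumption (A1)); (2) set $\pi^{t+1}_s=\mathrm{Proj}^h_{\Delta(\mathcal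 A)}(\nabla h^*(\eta_tf^{t+1}_s))$ for all $s\in\mathcal S$. Notation: $f^{t}=f^{\theta^{t}}$, $V^t=V^{\pi^t}$, $Q^t=Q^{\pi^t}$, $d_\mu^t=d_\mu^{\pi^t}$. Outer expectations $\mathbb E$ are over the randomness of the algorithm; (A2) holds for (almost) every realization. All expectations appearing are assumed well defined. *)

theory Defs
  imports "HOL-Probability.Probability"
begin

section \<open>Markov decision processes\<close>

text \<open>
  The state space is a measurable space \<open>S\<close>; a discrete (possibly uncountable) state space is the
  instance \<open>S = count_space UNIV\<close>, for which every measurability condition on \<open>S\<close> is trivial.
  The finite action set is the type \<open>'a\<close>.
\<close>

abbreviation state_action :: "'s measure \<Rightarrow> ('s \<times> 'a) measure" where
  "state_action S \<equiv> S \<Otimes>\<^sub>M count_space UNIV"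

locale mdp =
  fixes S :: "'s measure"
    and P :: "'s \<times> 'a::finite \<Rightarrow> 's measure"
    and r :: "'s \<times> 'a \<Rightarrow> real"
    and \<gamma> :: real
    and \<mu> :: "'s measure"
  assumes transition: "P \<in> state_action S \<rightarrow>\<^sub>M prob_algebra S"
    and reward_measurable: "r \<in> borel_measurable (state_action S)"
    and reward_bounds: "\<And>z. z \<in> space (state_action S) \<Longrightarrow> 0 \<le> r z \<and> r z \<le> 1"
    and discount: "0 \<le> \<gamma>" "\<gamma> < 1"
    and initial: "\<mu> \<in> space (prob_algebra S)"

definition prob_simplex :: "(real ^ 'a::finite) set" where
  "prob_simplex = {x. (\<forall>a. 0 \<le> x $ a) \<and> (\<Sum>a\<in>UNIV. x $ a) = 1}"

definition policy :: "'s measure \<Rightarrow> ('s \<Rightarrow> real ^ 'a::finite) \<Rightarrow> bool" where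
  "policy S \<pi> \<longleftrightarrow> \<pi> \<in> borel_measurable S \<and> (\<forall>s\<in>space S. \<pi> s \<in> prob_simplex)"

text \<open>The law of \<open>(s, a)\<close> with \<open>s \<sim> N\<close> and \<open>a \<sim> \<pi>(\<cdot> | s)\<close>.\<close>

definition with_action ::
    "'s measure \<Rightarrow> ('s \<Rightarrow> real ^ 'a::finite) \<Rightarrow> 's measure \<Rightarrow> ('s \<times> 'a) measure" where
  "with_action S \<pi> N =
     N \<bind> (\<lambda>s. distr (point_measure UNIV (\<lambda>a. ennreal (\<pi> s $ a))) (state_action S) (Pair s))"

text \<open>
  The law of the trajectory \<open>((s\<^sub>t, a\<^sub>t))\<^sub>t\<close> started from \<open>(s\<^sub>0, a\<^sub>0) \<sim> \<rho>\<close>, with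
  \<open>s\<^sub>t\<^sub>+\<^sub>1 \<sim> P(\<cdot> | s\<^sub>t, a\<^sub>t)\<close> and \<open>a\<^sub>t\<^sub>+\<^sub>1 \<sim> \<pi>(\<cdot> | s\<^sub>t\<^sub>+\<^sub>1)\<close>. It is the Ionescu-Tulcea limit
  (\<open>Ionescu_Tulcea.PF.lim\<close>) of the kernels \<open>trajectory_kernel\<close>.
\<close>

definition trajectory_kernel ::
    "'s measure \<Rightarrow> ('s \<times> 'a::finite \<Rightarrow> 's measure) \<Rightarrow> ('s \<Rightarrow> real ^ 'a) \<Rightarrow> ('s \<times> 'a) measure
      \<Rightarrow> nat \<Rightarrow> (nat \<Rightarrow> 's \<times> 'a) \<Rightarrow> ('s \<times> 'a) measure" where
  "trajectory_kernel S P \<pi> \<rho> n x =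
     (case n of 0 \<Rightarrow> \<rho> | Suc m \<Rightarrow> with_action S \<pi> (P (x m)))"

definition trajectory ::
    "'s measure \<Rightarrow> ('s \<times> 'a::finite \<Rightarrow> 's measure) \<Rightarrow> ('s \<Rightarrow> real ^ 'a) \<Rightarrow> ('s \<times> 'a) measure
      \<Rightarrow> (nat \<Rightarrow> 's \<times> 'a) measure" where
  "trajectory S P \<pi> \<rho> =
     projective_family.lim UNIV
       (Ionescu_Tulcea.CI (trajectory_kernel S P \<pi> \<rho>) (\<lambda>_. state_action S)) (\<lambda>_. state_action S)"

definition trajectory_from ::
    "'s measure \<Rightarrow> ('s \<times> 'a::finite \<Rightarrow> 's measure) \<Rightarrow> ('s \<Rightarrow> real ^ 'a) \<Rightarrow> 's
      \<Rightarrow> (nat \<Rightarrow> 's \<times> 'a) measure" where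
  "trajectory_from S P \<pi> s = trajectory S P \<pi> (with_action S \<pi> (return S s))"

definition state_value ::
    "'s measure \<Rightarrow> ('s \<times> 'a::finite \<Rightarrow> 's measure) \<Rightarrow> ('s \<times> 'a \<Rightarrow> real) \<Rightarrow> real
      \<Rightarrow> ('s \<Rightarrow> real ^ 'a) \<Rightarrow> 's \<Rightarrow> real" where
  "state_value S P r \<gamma> \<pi> s = (\<integral>x. (\<Sum>t. \<gamma> ^ t * r (x t)) \<partial>trajectory_from S P \<pi> s)"

definition action_value ::
    "'s measure \<Rightarrow> ('s \<times> 'a::finite \<Rightarrow> 's measure) \<Rightarrow> ('s \<times> 'a \<Rightarrow> real) \<Rightarrow> real
      \<Rightarrow> ('s \<Rightarrow> real ^ 'a) \<Rightarrow> 's \<times> 'a \<Rightarrow> real" where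
  "action_value S P r \<gamma> \<pi> z =
     (\<integral>x. (\<Sum>t. \<gamma> ^ t * r (x t)) \<partial>trajectory S P \<pi> (return (state_action S) z))"

definition start_value ::
    "'s measure \<Rightarrow> ('s \<times> 'a::finite \<Rightarrow> 's measure) \<Rightarrow> ('s \<times> 'a \<Rightarrow> real) \<Rightarrow> real \<Rightarrow> 's measure
      \<Rightarrow> ('s \<Rightarrow> real ^ 'a) \<Rightarrow> real" where
  "start_value S P r \<gamma> \<mu> \<pi> = (\<integral>s. state_value S P r \<gamma> \<pi> s \<partial>\<mu>)"

definition optimal_policy ::
    "'s measure \<Rightarrow> ('s \<times> 'a::finite \<Rightarrow> 's measure) \<Rightarrow> ('s \<times> 'a \<Rightarrow> real) \<Rightarrow> real \<Rightarrow> 's measure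
      \<Rightarrow> ('s \<Rightarrow> real ^ 'a) \<Rightarrow> bool" where
  "optimal_policy S P r \<gamma> \<mu> \<pi>\<^sub>o \<longleftrightarrow> policy S \<pi>\<^sub>o \<and>
     (\<forall>\<pi>. policy S \<pi> \<longrightarrow> start_value S P r \<gamma> \<mu> \<pi> \<le> start_value S P r \<gamma> \<mu> \<pi>\<^sub>o)"

text \<open>
  The discounted state visitation distribution as a measure; for discrete \<open>S\<close>, evaluating it at
  \<open>B = {s}\<close> gives the usual mass function.
\<close>

definition visitation ::
    "'s measure \<Rightarrow> ('s \<times> 'a::finite \<Rightarrow> 's measure) \<Rightarrow> real \<Rightarrow> 's measure
      \<Rightarrow> ('s \<Rightarrow> real ^ 'a) \<Rightarrow> 's measure" where
  "visitation S P \<gamma> \<mu> \<pi> = measure_of (space S) (sets S) (\<lambda>B.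
     ennreal (1 - \<gamma>) *
     (\<integral>\<^sup>+s\<^sub>0. (\<Sum>t. ennreal (\<gamma> ^ t) *
        emeasure (trajectory_from S P \<pi> s\<^sub>0)
          {x \<in> space (trajectory_from S P \<pi> s\<^sub>0). fst (x t) \<in> B}) \<partial>\<mu>))"

text \<open>
  \<open>w(s, a) = d(s) \<pi>(a | s) / v(s, a)\<close>, the densities of \<open>d\<close> and \<open>v\<close> being taken with respect to a
  common reference measure \<open>\<nu>\<close> (times counting measure on actions); mass functions are the case
  \<open>\<nu> = count_space UNIV\<close>. The ratio is determined \<open>v\<close>-almost everywhere, independently of \<open>\<nu>\<close>.
\<close>

definition density_ratio ::
    "'s measure \<Rightarrow> 's measure \<Rightarrow> ('s \<Rightarrow> real ^ 'a::finite) \<Rightarrow> ('s \<times> 'a) measure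
      \<Rightarrow> ('s \<times> 'a \<Rightarrow> real) \<Rightarrow> bool" where
  "density_ratio S d \<pi> v w \<longleftrightarrow> (\<exists>\<nu> p q.
     sets \<nu> = sets S \<and>
     p \<in> borel_measurable \<nu> \<and> (\<forall>s\<in>space \<nu>. 0 \<le> p s) \<and> d = density \<nu> (\<lambda>s. ennreal (p s)) \<and>
     q \<in> borel_measurable (state_action \<nu>) \<and> (\<forall>z\<in>space (state_action \<nu>). 0 \<le> q z) \<and>
     v = density (state_action \<nu>) (\<lambda>z. ennreal (q z)) \<and>
     (\<forall>s\<in>space \<nu>. \<forall>a. 0 < p s * \<pi> s $ a \<longrightarrow> 0 < q (s, a)) \<and>
     w = (\<lambda>(s, a). p s * \<pi> s $ a / q (s, a)))"

text \<open>Squared \<open>L\<^sub>2(v)\<close> norm, with value \<open>\<infinity>\<close> when it is infinite.\<close>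

definition L2_norm_sq :: "'z measure \<Rightarrow> ('z \<Rightarrow> real) \<Rightarrow> ennreal" where
  "L2_norm_sq v y = (\<integral>\<^sup>+z. ennreal ((y z)\<^sup>2) \<partial>v)"


section \<open>Mirror maps\<close>

text \<open>The gradient is only meaningful at points of differentiability.\<close>

definition grad :: "('e::euclidean_space \<Rightarrow> real) \<Rightarrow> 'e \<Rightarrow> 'e" where
  "grad h x = (THE D. GDERIV h x :> D)"

definition strictly_convex_on :: "'e::real_vector set \<Rightarrow> ('e \<Rightarrow> real) \<Rightarrow> bool" where
  "strictly_convex_on Y h \<longleftrightarrow>
     (\<forall>x\<in>Y. \<forall>y\<in>Y. \<forall>u. x \<noteq> y \<and> 0 < u \<and> u < 1 \<longrightarrow>
        h ((1 - u) *\<^sub>R x + u *\<^sub>R y) < (1 - u) * h x + u * h y)"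

locale mirror_map =
  fixes Y :: "(real ^ 'a::finite) set" and h :: "real ^ 'a \<Rightarrow> real"
  assumes convex_domain: "convex Y"
    and simplex_subset: "prob_simplex \<subseteq> Y"
    and strictly_convex: "strictly_convex_on Y h"
    and continuous: "continuous_on Y h"
    and differentiable: "\<And>x. x \<in> interior Y \<Longrightarrow> \<exists>D. GDERIV h x :> D"
    and gradient_continuous: "continuous_on (interior Y) (grad h)"
    and essentially_smooth:
      "\<And>z. z \<in> frontier Y \<Longrightarrow> filterlim (\<lambda>x. norm (grad h x)) at_top (at z within interior Y)"
    and gradient_surjective: "grad h ` interior Y = UNIV"

definition conjugate :: "(real ^ 'a::finite) set \<Rightarrow> (real ^ 'a \<Rightarrow> real) \<Rightarrow> real ^ 'a \<Rightarrow> real" where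
  "conjugate Y h y = (SUP x\<in>Y. y \<bullet> x - h x)"

definition bregman :: "(real ^ 'a::finite \<Rightarrow> real) \<Rightarrow> real ^ 'a \<Rightarrow> real ^ 'a \<Rightarrow> real" where
  "bregman h x y = h x - h y - grad h y \<bullet> (x - y)"

definition bregman_proj :: "(real ^ 'a::finite \<Rightarrow> real) \<Rightarrow> real ^ 'a \<Rightarrow> real ^ 'a" where
  "bregman_proj h y = arg_min_on (\<lambda>x. bregman h x y) prob_simplex"

end

theory Submission
  imports Defs
begin

text \<open>
  The policy update minimises \<open>h x - \<eta>\<^sub>t \<langle>f\<^sub>s, x\<rangle>\<close> over the simplex, and essential smoothness keeps the
  minimiser in the interior of \<open>\<Y>\<close>. Its variational inequality, tested at the previous policy, bounds
  the symmetrised Bregman divergence by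
  \<open>\<langle>\<eta>\<^sub>t f\<^sub>s - \<nabla>h(\<pi>\<^sub>s), \<pi>'\<^sub>s - \<pi>\<^sub>s\<rangle> = \<eta>\<^sub>t \<langle>Q\<^sub>s + err\<^sub>s, \<pi>'\<^sub>s - \<pi>\<^sub>s\<rangle>\<close>. Averaged over the visitation
  distribution of the new policy, the \<open>Q\<close> term is the value improvement by the performance
  difference lemma; each of the two error terms is an integral of \<open>err\<close> against a density ratio,
  which Cauchy-Schwarz bounds by \<open>sqrt (C\<^sub>v L)\<close>, where \<open>L\<close> is the squared \<open>L\<^sub>2(v)\<close> error. Jensen's
  inequality for the square root takes care of the outer expectation.
\<close>

section \<open>Mirror maps and Bregman projections\<close>

text \<open>\<open>grad h\<close> is an unspecified vector wherever \<open>h\<close> is not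
  differentiable, so first-order arguments are available only at interior points. Every iterate must
  therefore be shown to lie in \<open>interior Y\<close>; the leverage for this is a simplex point
  that is already interior, and the initial policy supplies one in every state. On a general state
  space the iterates must also be measurable in the state. This is why the update is shown to be a
  continuous function of its dual argument. The factor 2 in the bound counts the two error terms:
  both are averaged over the visitation law of the new policy, one with the actions of the new
  policy and one with those of the old. They correspond to the pairs (d^{t+1}, \<pi>^{t+1}) and
  (d^{t+1}, \<pi>^t) of (A2). Integrability of the Bregman term is derived, not assumed:
  monotonicity of the gradient makes the term nonnegative, so the upper bound also dominates it.
  This is used twice, under the visitation law and over the randomness of the algorithm.\<close>

lemma grad_eqI: "GDERIV h x :> D \<Longrightarrow> grad h x = D"
  unfolding grad_def
proof (rule the_equality)
  fix D' assume "GDERIV h x :> D" "GDERIV h x :> D'"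
  then have "(\<lambda>d. d \<bullet> D') = (\<lambda>d. d \<bullet> D)"
    unfolding gderiv_def by (rule has_derivative_unique[rotated])
  then show "D' = D"
    by (metis inner_commute vector_eq_ldot)
qed

lemma convex_prob_simplex: "convex (prob_simplex :: (real ^ 'a::finite) set)"
  unfolding convex_def prob_simplex_def
  by (auto simp: sum.distrib sum_distrib_left[symmetric])

lemma closed_prob_simplex: "closed (prob_simplex :: (real ^ 'a::finite) set)"
  unfolding prob_simplex_def
  by (intro closed_Collect_conj closed_Collect_all closed_Collect_le closed_Collect_eq
      continuous_intros)

lemma prob_simplex_le_1: "x \<in> prob_simplex \<Longrightarrow> x $ a \<le> 1"
proof -
  assume x: "x \<in> prob_simplex"
  then have "x $ a \<le> (\<Sum>a\<in>UNIV. x $ a)"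
    by (intro member_le_sum) (auto simp: prob_simplex_def)
  with x show ?thesis by (auto simp: prob_simplex_def)
qed

lemma compact_prob_simplex: "compact (prob_simplex :: (real ^ 'a::finite) set)"
proof -
  have "norm x \<le> real CARD('a)" if x: "x \<in> prob_simplex" for x :: "real ^ 'a"
  proof -
    have "norm x \<le> (\<Sum>a\<in>UNIV. \<bar>x $ a\<bar>)" by (rule norm_le_l1_cart)
    also have "\<dots> \<le> (\<Sum>a\<in>(UNIV::'a set). 1)"
      using x prob_simplex_le_1[OF x] by (intro sum_mono) (auto simp: prob_simplex_def)
    finally show ?thesis by simp
  qed
  then show ?thesis
    using closed_prob_simplex by (auto simp: compact_eq_bounded_closed bounded_iff)
qed

lemma prob_simplex_not_empty: "(prob_simplex :: (real ^ 'a::finite) set) \<noteq> {}"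
proof -
  have "axis (undefined :: 'a) (1 :: real) \<in> prob_simplex"
    by (auto simp: prob_simplex_def axis_def)
  then show ?thesis by blast
qed

section \<open>First-order inequalities for the mirror map\<close>

context mirror_map
begin

lemma convex_on_domain: "convex_on Y h"
proof (rule convex_onI[OF _ convex_domain])
  fix t :: real and x y
  assume "0 < t" "t < 1" "x \<in> Y" "y \<in> Y"
  then show "h ((1 - t) *\<^sub>R x + t *\<^sub>R y) \<le> (1 - t) * h x + t * h y"
    using strictly_convex unfolding strictly_convex_on_def
    by (cases "x = y") (auto simp: less_imp_le scaleR_left_diff_distrib left_diff_distrib)
qed

lemma GDERIV_grad: "x \<in> interior Y \<Longrightarrow> GDERIV h x :> grad h x"
  using differentiable grad_eqI by metis

lemma interior_domain: "x \<in> interior Y \<Longrightarrow> x \<in> Y"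
  using interior_subset by blast

lemma DERIV_along_line:
  assumes "x + u *\<^sub>R d \<in> interior Y"
  shows "((\<lambda>u. h (x + u *\<^sub>R d)) has_real_derivative grad h (x + u *\<^sub>R d) \<bullet> d) (at u)"
proof -
  have "((\<lambda>u. h (x + u *\<^sub>R d)) has_derivative (\<lambda>k. (k *\<^sub>R d) \<bullet> grad h (x + u *\<^sub>R d))) (at u)"
    using GDERIV_grad[OF assms] unfolding gderiv_def
    by (intro has_derivative_compose[of "\<lambda>u. x + u *\<^sub>R d" "\<lambda>k. k *\<^sub>R d" u UNIV h])
       (auto intro!: derivative_eq_intros)
  then show ?thesis
    unfolding has_field_derivative_def by (simp add: inner_commute mult_commute_abs)
qed

text \<open>By convexity the difference quotients from \<open>x\<close> towards \<open>y\<close>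
  stay below \<open>h y - h x\<close>, and they tend to the directional derivative. The point
  \<open>y\<close> may lie on the boundary, which is what the comparison with a hypothetical
  boundary minimiser requires.\<close>

lemma gradient_inequality:
  assumes x: "x \<in> interior Y" and y: "y \<in> Y"
  shows "h x + grad h x \<bullet> (y - x) \<le> h y"
proof -
  have "((\<lambda>u. h (x + u *\<^sub>R (y - x))) has_real_derivative grad h x \<bullet> (y - x)) (at 0)"
    using DERIV_along_line[of x 0 "y - x"] x by simp
  then have "((\<lambda>u. (h (x + u *\<^sub>R (y - x)) - h x) / u) \<longlongrightarrow> grad h x \<bullet> (y - x)) (at_right 0)"
    unfolding has_field_derivative_iff by (auto intro: tendsto_mono at_le)
  moreover have "\<forall>\<^sub>F u in at_right 0. (h (x + u *\<^sub>R (y - x)) - h x) / u \<le> h y - h x"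
    unfolding eventually_at_right_field
  proof (intro exI[of _ 1] conjI allI impI)
    fix u :: real assume u: "0 < u" "u < 1"
    have "h ((1 - u) *\<^sub>R x + u *\<^sub>R y) \<le> (1 - u) * h x + u * h y"
      using convex_onD[OF convex_on_domain, of u x y] u interior_domain[OF x] y by simp
    then have "h (x + u *\<^sub>R (y - x)) - h x \<le> u * (h y - h x)"
      by (simp add: algebra_simps)
    with u show "(h (x + u *\<^sub>R (y - x)) - h x) / u \<le> h y - h x"
      by (simp add: divide_le_eq mult.commute)
  qed simp
  ultimately have "grad h x \<bullet> (y - x) \<le> h y - h x"
    by (intro tendsto_upperbound) auto
  then show ?thesis by simp
qed

text \<open>The weak inequality at the midpoint of \<open>x\<close> and \<open>y\<close>, combined
  with strict convexity there.\<close>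

lemma gradient_inequality_strict:
  assumes x: "x \<in> interior Y" and y: "y \<in> Y" and neq: "x \<noteq> y"
  shows "h x + grad h x \<bullet> (y - x) < h y"
proof -
  let ?m = "(1 - 1/2) *\<^sub>R x + (1/2) *\<^sub>R y"
  have "?m \<in> Y"
    using convexD_alt[OF convex_domain interior_domain[OF x] y, of "1/2"] by simp
  then have "h x + grad h x \<bullet> (?m - x) \<le> h ?m"
    by (rule gradient_inequality[OF x])
  moreover have "?m - x = (1/2) *\<^sub>R (y - x)"
    by (simp add: vec_eq_iff field_simps)
  moreover have "h ?m < (1 - 1/2) * h x + (1/2) * h y"
    using strictly_convex interior_domain[OF x] y neq unfolding strictly_convex_on_def
    by (elim ballE allE[of _ "1/2"]) auto
  ultimately show ?thesis by simp
qed

lemma grad_monotone: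
  assumes "x \<in> interior Y" "y \<in> interior Y"
  shows "0 \<le> (grad h x - grad h y) \<bullet> (x - y)"
  using gradient_inequality[OF assms(1) interior_domain[OF assms(2)]]
    gradient_inequality[OF assms(2) interior_domain[OF assms(1)]]
  by (simp add: inner_diff_left inner_diff_right)

lemma bregman_symmetrized:
  "bregman h x y + bregman h y x = (grad h x - grad h y) \<bullet> (x - y)"
  by (simp add: bregman_def inner_diff_left inner_diff_right)

section \<open>The inverse gradient as the gradient of the conjugate\<close>

lemma inj_on_grad: "inj_on (grad h) (interior Y)"
proof (rule inj_onI, rule ccontr)
  fix x y assume x: "x \<in> interior Y" and y: "y \<in> interior Y"
    and eq: "grad h x = grad h y" and neq: "x \<noteq> y"
  \<comment> \<open>With equal gradients the two strict inequalities add up to 0 < 0.\<close>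
  show False
    using gradient_inequality_strict[OF x interior_domain[OF y] neq]
      gradient_inequality_strict[OF y interior_domain[OF x] neq[symmetric]] eq
    by (simp add: inner_diff_right)
qed

text \<open>This is \<nabla>h^* introduced as an inverse function, before the conjugate is known to
  be differentiable; \<open>grad_conjugate\<close> reconciles the two descriptions.\<close>

definition dual_point :: "real ^ 'a \<Rightarrow> real ^ 'a" where
  "dual_point = the_inv_into (interior Y) (grad h)"

lemma dual_point_interior: "dual_point y \<in> interior Y"
  unfolding dual_point_def by (rule the_inv_into_into[OF inj_on_grad]) (auto simp: gradient_surjective)

lemma grad_dual_point: "grad h (dual_point y) = y"
  unfolding dual_point_def by (rule f_the_inv_into_f[OF inj_on_grad]) (simp add: gradient_surjective)

text \<open>Invariance of domain: the gradient is a continuous injection of an open set into a space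
  of the same dimension, so its inverse is continuous on the image, here the whole space.\<close>

lemma continuous_dual_point: "continuous_on UNIV dual_point"
  using continuous_on_inverse_open[OF open_interior gradient_continuous order_refl, of dual_point]
  by (simp add: gradient_surjective dual_point_def the_inv_into_f_f[OF inj_on_grad])

text \<open>The gradient inequality at \<open>dual_point y\<close>, where the gradient is
  \<open>y\<close>. It says that the supremum defining the conjugate is attained at
  \<open>dual_point y\<close>.\<close>

lemma conjugate_upper: "x \<in> Y \<Longrightarrow> y \<bullet> x - h x \<le> y \<bullet> dual_point y - h (dual_point y)"
  using gradient_inequality[OF dual_point_interior, of x y]
  by (simp add: grad_dual_point inner_diff_right)

lemma conjugate_eq: "conjugate Y h y = y \<bullet> dual_point y - h (dual_point y)"
  unfolding conjugate_def
  by (rule cSup_eq_maximum) (auto intro: conjugate_upper interior_domain[OF dual_point_interior])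

lemma GDERIV_conjugate: "GDERIV (conjugate Y h) y :> dual_point y"
  unfolding gderiv_def has_derivative_at
proof
  show "bounded_linear (\<lambda>d. d \<bullet> dual_point y)"
    by (rule bounded_linear_inner_left)
  show "(\<lambda>d. norm (conjugate Y h (y + d) - conjugate Y h y - d \<bullet> dual_point y) / norm d) \<midarrow>0\<rightarrow> 0"
  proof (rule Lim_null_comparison)
    show "\<forall>\<^sub>F d in at 0.
      norm (norm (conjugate Y h (y + d) - conjugate Y h y - d \<bullet> dual_point y) / norm d)
        \<le> norm (dual_point (y + d) - dual_point y)"
    proof (rule always_eventually, rule allI)
      fix d
      \<comment> \<open>The remainder is squeezed: below because \<open>dual_point y\<close>
        competes in the supremum at \<open>y + d\<close>, above because
        \<open>dual_point (y + d)\<close> competes in the supremum at \<open>y\<close>. Continuity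
        of \<open>dual_point\<close> then makes it o(norm d).\<close>
      have "0 \<le> conjugate Y h (y + d) - conjugate Y h y - d \<bullet> dual_point y"
        using conjugate_upper[OF interior_domain[OF dual_point_interior], of "y + d" y]
        by (simp add: conjugate_eq inner_add_left)
      moreover have "conjugate Y h (y + d) - conjugate Y h y - d \<bullet> dual_point y
          \<le> d \<bullet> (dual_point (y + d) - dual_point y)"
        using conjugate_upper[OF interior_domain[OF dual_point_interior], of y "y + d"]
        by (simp add: conjugate_eq inner_add_left inner_diff_right)
      moreover have "\<dots> \<le> norm d * norm (dual_point (y + d) - dual_point y)"
        by (rule norm_cauchy_schwarz)
      ultimately show "norm (norm (conjugate Y h (y + d) - conjugate Y h y - d \<bullet> dual_point y) / norm d)
          \<le> norm (dual_point (y + d) - dual_point y)"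
        by (cases "d = 0") (auto simp: divide_le_eq mult.commute)
    qed
    have "continuous (at y) dual_point"
      using continuous_dual_point by (simp add: continuous_on_eq_continuous_at)
    then have "(\<lambda>d. dual_point (y + d)) \<midarrow>0\<rightarrow> dual_point y"
      unfolding continuous_at by (rule LIM_offset_zero)
    then show "(\<lambda>d. norm (dual_point (y + d) - dual_point y)) \<midarrow>0\<rightarrow> 0"
      by (intro tendsto_norm_zero LIM_zero)
  qed
qed

lemma grad_conjugate: "grad (conjugate Y h) y = dual_point y"
  by (rule grad_eqI[OF GDERIV_conjugate])

section \<open>The policy update as a minimisation over the simplex\<close>

definition mirror_step :: "real ^ 'a \<Rightarrow> real ^ 'a" where
  "mirror_step y = bregman_proj h (grad (conjugate Y h) y)"

lemma continuous_on_objective: "continuous_on prob_simplex (\<lambda>x. h x - y \<bullet> x)"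
  by (intro continuous_intros continuous_on_subset[OF continuous simplex_subset])

text \<open>As a function of its first argument, the divergence from \<open>dual_point y\<close>
  differs from \<open>h p - y \<bullet> p\<close> by a constant. A minimiser exists by compactness
  of the simplex, so the choice operator behind \<open>arg_min_on\<close> returns a genuine
  one.\<close>

lemma mirror_step_is_minimizer:
  "mirror_step y \<in> prob_simplex \<and>
    (\<forall>p\<in>prob_simplex. h (mirror_step y) - y \<bullet> mirror_step y \<le> h p - y \<bullet> p)"
proof -
  obtain x where x: "x \<in> prob_simplex" "\<forall>p\<in>prob_simplex. h x - y \<bullet> x \<le> h p - y \<bullet> p"
    using continuous_attains_inf[OF compact_prob_simplex prob_simplex_not_empty
        continuous_on_objective] by blast
  have breg: "bregman h p (dual_point y) = (h p - y \<bullet> p) + (y \<bullet> dual_point y - h (dual_point y))" for p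
    by (simp add: bregman_def grad_dual_point inner_diff_right)
  have "is_arg_min (\<lambda>x. bregman h x (dual_point y)) (\<lambda>x. x \<in> prob_simplex) x"
    using x by (auto simp: is_arg_min_linorder breg)
  then have "is_arg_min (\<lambda>x. bregman h x (dual_point y)) (\<lambda>x. x \<in> prob_simplex) (mirror_step y)"
    unfolding mirror_step_def bregman_proj_def arg_min_on_def arg_min_def grad_conjugate
    by (rule someI)
  then show ?thesis
    by (auto simp: is_arg_min_linorder breg)
qed

lemma mirror_step_in_simplex: "mirror_step y \<in> prob_simplex"
  using mirror_step_is_minimizer by blast

lemma mirror_step_le: "p \<in> prob_simplex \<Longrightarrow> h (mirror_step y) - y \<bullet> mirror_step y \<le> h p - y \<bullet> p"
  using mirror_step_is_minimizer by blast

text \<open>The midpoint of two distinct minimisers would have a strictly smaller objective.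
  Uniqueness serves to identify limits of minimisers in the continuity proof.\<close>

lemma minimizer_unique:
  assumes x: "x \<in> prob_simplex" "\<And>p. p \<in> prob_simplex \<Longrightarrow> h x - y \<bullet> x \<le> h p - y \<bullet> p"
  shows "x = mirror_step y"
proof (rule ccontr)
  assume neq: "x \<noteq> mirror_step y"
  let ?z = "mirror_step y" and ?m = "(1 - 1/2) *\<^sub>R x + (1/2) *\<^sub>R mirror_step y"
  have "?m \<in> prob_simplex"
    using convexD_alt[OF convex_prob_simplex x(1) mirror_step_in_simplex, of "1/2"] by simp
  then have "h x - y \<bullet> x \<le> h ?m - y \<bullet> ?m" "h ?z - y \<bullet> ?z \<le> h ?m - y \<bullet> ?m"
    using x(2) mirror_step_le by blast+
  moreover have "y \<bullet> ?m = (1/2) * (y \<bullet> x) + (1/2) * (y \<bullet> ?z)"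
    by (simp add: inner_add_right)
  moreover have "h ?m < (1 - 1/2) * h x + (1/2) * h ?z"
    using strictly_convex x(1) mirror_step_in_simplex[of y] simplex_subset neq
    unfolding strictly_convex_on_def
    by (elim ballE[of _ _ x] ballE[of _ _ ?z] allE[of _ "1/2"]) auto
  ultimately show False by simp
qed

text \<open>A map into a compact set with closed graph is continuous. The graph is closed because a
  limit of minimisers minimises the limit objective, and that minimiser is unique. Continuity is
  what makes the updated policies measurable in the state.\<close>

lemma continuous_mirror_step: "continuous_on UNIV mirror_step"
proof (rule continuous_from_closed_graph[OF compact_prob_simplex])
  show "mirror_step \<in> UNIV \<rightarrow> prob_simplex"
    using mirror_step_in_simplex by auto
  have "(y, x) \<in> range (\<lambda>y. (y, mirror_step y))"
    if lim: "((\<lambda>n. (u n, mirror_step (u n))) \<longlongrightarrow> (y, x)) sequentially" for u y x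
  proof -
    have u: "u \<longlonglongrightarrow> y" and mx: "(\<lambda>n. mirror_step (u n)) \<longlonglongrightarrow> x"
      using tendsto_fst[OF lim] tendsto_snd[OF lim] by simp_all
    have x: "x \<in> prob_simplex"
      by (rule closed_sequentially[OF closed_prob_simplex _ mx]) (rule mirror_step_in_simplex)
    have hx: "(\<lambda>n. h (mirror_step (u n))) \<longlonglongrightarrow> h x"
      by (rule continuous_on_tendsto_compose[OF continuous_on_subset[OF continuous simplex_subset] mx x])
         (simp add: mirror_step_in_simplex)
    have "h x - y \<bullet> x \<le> h p - y \<bullet> p" if p: "p \<in> prob_simplex" for p
    proof (rule LIMSEQ_le)
      show "(\<lambda>n. h (mirror_step (u n)) - u n \<bullet> mirror_step (u n)) \<longlonglongrightarrow> h x - y \<bullet> x"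
        by (intro tendsto_intros hx u mx)
      show "(\<lambda>n. h p - u n \<bullet> p) \<longlonglongrightarrow> h p - y \<bullet> p"
        by (intro tendsto_intros u)
    qed (use p mirror_step_le in blast)
    from minimizer_unique[OF x this] show ?thesis by auto
  qed
  then show "closed (range (\<lambda>y. (y, mirror_step y)))"
    unfolding closed_sequential_limits
  proof (intro allI impI, elim conjE)
    fix w l assume closed: "\<And>u y x. ((\<lambda>n. (u n, mirror_step (u n))) \<longlongrightarrow> (y, x)) sequentially
        \<Longrightarrow> (y, x) \<in> range (\<lambda>y. (y, mirror_step y))"
      and "\<forall>n. w n \<in> range (\<lambda>y. (y, mirror_step y))" and l: "w \<longlonglongrightarrow> l"
    then have "w = (\<lambda>n. (fst (w n), mirror_step (fst (w n))))"
      by (auto simp: image_iff fun_eq_iff) (metis fst_conv)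
    with l closed[of "\<lambda>n. fst (w n)" "fst l" "snd l"] show "l \<in> range (\<lambda>y. (y, mirror_step y))"
      by simp
  qed
qed

text \<open>
  At a boundary point \<open>x\<close>, the gradient blow-up forces the directional derivative of \<open>h\<close> towards an
  interior point to \<open>-\<infinity>\<close>: testing the gradient inequality against a whole ball around \<open>x\<^sub>1\<close>
  turns the norm of the gradient into a term of the bound.
\<close>

lemma steep_descent_from_frontier:
  assumes x: "x \<in> Y" "x \<notin> interior Y" and x1: "x\<^sub>1 \<in> interior Y"
  shows "filterlim (\<lambda>u. grad h (x + u *\<^sub>R (x\<^sub>1 - x)) \<bullet> (x\<^sub>1 - x)) at_bot (at_right 0)"
proof -
  define z where "z u = x + u *\<^sub>R (x\<^sub>1 - x)" for u :: real
  have z_int: "z u \<in> interior Y" if "0 < u" "u \<le> 1" for u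
    using mem_interior_convex_shrink[OF convex_domain x1 x(1) that]
    by (simp add: z_def algebra_simps)
  obtain e where e: "0 < e" "cball x\<^sub>1 e \<subseteq> interior Y"
    using open_contains_cball[of "interior Y"] x1 by auto
  obtain M where M: "\<And>p. p \<in> cball x\<^sub>1 e \<Longrightarrow> h p \<le> M"
    using continuous_attains_sup[OF compact_cball, of x\<^sub>1 e h] e
      continuous_on_subset[OF continuous] interior_subset
    by (metis (no_types, lifting) cball_eq_empty less_le_not_le order_trans)
  have seg: "closed_segment x x\<^sub>1 \<subseteq> Y"
    using closed_segment_subset[OF x(1) interior_domain[OF x1] convex_domain] .
  obtain m where m: "\<And>p. p \<in> closed_segment x x\<^sub>1 \<Longrightarrow> m \<le> h p"
    using continuous_attains_inf[OF compact_segment _ continuous_on_subset[OF continuous seg]]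
    by (metis empty_iff ends_in_segment(1))
  \<comment> \<open>The restriction \<open>u \<le> 1/2\<close> keeps the factor \<open>1 - u\<close>
    at least 1/2; dividing by it produces the 2 when the directional derivative is
    nonnegative.\<close>
  have bound: "grad h (z u) \<bullet> (x\<^sub>1 - x) \<le> 2 * \<bar>M - m\<bar> - e * norm (grad h (z u))"
    if u: "0 < u" "u \<le> 1/2" for u
  proof -
    let ?g = "grad h (z u)"
    \<comment> \<open>The point of the ball that is furthest in the direction of the gradient:
      \<open>sgn ?g\<close> is the normalised gradient, so the inner product gains
      \<open>e * norm ?g\<close>.\<close>
    let ?p = "x\<^sub>1 + e *\<^sub>R sgn ?g"
    have p: "?p \<in> cball x\<^sub>1 e"
      using e by (auto simp: dist_norm norm_sgn)
    have "z u \<in> closed_segment x x\<^sub>1"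
      using u by (auto simp: z_def closed_segment_def algebra_simps intro!: exI[of _ u])
    then have "m \<le> h (z u)" by (rule m)
    moreover have "h (z u) + ?g \<bullet> (?p - z u) \<le> h ?p"
      using gradient_inequality[OF z_int, of u ?p] u p e interior_subset by fastforce
    moreover have "h ?p \<le> M" using M p by blast
    moreover have "?g \<bullet> (?p - z u) = (1 - u) * (?g \<bullet> (x\<^sub>1 - x)) + e * norm ?g"
    proof -
      have "?p - z u = (1 - u) *\<^sub>R (x\<^sub>1 - x) + e *\<^sub>R sgn ?g"
        by (simp add: z_def algebra_simps)
      moreover have "?g \<bullet> sgn ?g = norm ?g"
        by (cases "?g = 0") (simp_all add: sgn_div_norm dot_square_norm power2_eq_square)
      ultimately show ?thesis by (simp only: inner_add_right inner_scaleR_right)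
    qed
    ultimately have *: "(1 - u) * (?g \<bullet> (x\<^sub>1 - x)) \<le> \<bar>M - m\<bar> - e * norm ?g" by linarith
    show ?thesis
    proof (cases "0 \<le> ?g \<bullet> (x\<^sub>1 - x)")
      case True
      then have "(1/2) * (?g \<bullet> (x\<^sub>1 - x)) \<le> (1 - u) * (?g \<bullet> (x\<^sub>1 - x))"
        using u by (intro mult_right_mono) auto
      then have "(1/2) * (?g \<bullet> (x\<^sub>1 - x)) \<le> \<bar>M - m\<bar> - e * norm ?g"
        using * by (rule order_trans)
      moreover have "0 \<le> e * norm ?g" using e by simp
      ultimately show ?thesis by simp
    next
      case False
      then have "1 * (?g \<bullet> (x\<^sub>1 - x)) \<le> (1 - u) * (?g \<bullet> (x\<^sub>1 - x))"
        using u by (intro mult_right_mono_neg) auto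
      then have "?g \<bullet> (x\<^sub>1 - x) \<le> \<bar>M - m\<bar> - e * norm ?g"
        using * by (auto intro: order_trans)
      also have "\<dots> \<le> 2 * \<bar>M - m\<bar> - e * norm ?g" by simp
      finally show ?thesis .
    qed
  qed
  have "x \<in> frontier Y"
    using x closure_subset by (auto simp: frontier_def)
  then have "filterlim (\<lambda>x. norm (grad h x)) at_top (at x within interior Y)"
    by (rule essentially_smooth)
  moreover have "filterlim z (at x within interior Y) (at_right 0)"
    unfolding filterlim_at
  proof
    show "(z \<longlongrightarrow> x) (at_right 0)"
      unfolding z_def by (auto intro!: tendsto_eq_intros)
    show "\<forall>\<^sub>F u in at_right 0. z u \<in> interior Y \<and> z u \<noteq> x"
      unfolding eventually_at_right_field
      using z_int x by (intro exI[of _ 1]) (metis less_imp_le zero_less_one)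
  qed
  ultimately have "filterlim (\<lambda>u. norm (grad h (z u))) at_top (at_right 0)"
    by (rule filterlim_compose)
  then have "filterlim (\<lambda>u. e * norm (grad h (z u))) at_top (at_right 0)"
    using e by (intro filterlim_tendsto_pos_mult_at_top[OF tendsto_const]) auto
  then have "filterlim (\<lambda>u. - (2 * \<bar>M - m\<bar>) + e * norm (grad h (z u))) at_top (at_right 0)"
    by (rule filterlim_tendsto_add_at_top[OF tendsto_const])
  then have "filterlim (\<lambda>u. - (- (2 * \<bar>M - m\<bar>) + e * norm (grad h (z u)))) at_bot (at_right 0)"
    by (simp add: filterlim_uminus_at_top)
  moreover have "\<forall>\<^sub>F u in at_right 0. grad h (z u) \<bullet> (x\<^sub>1 - x)
      \<le> - (- (2 * \<bar>M - m\<bar>) + e * norm (grad h (z u)))"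
    unfolding eventually_at_right_field using bound by (intro exI[of _ "1/2"]) auto
  ultimately show ?thesis
    unfolding z_def by (rule filterlim_at_bot_mono)
qed

text \<open>At a boundary minimiser the slope of \<open>h\<close> towards the interior point
  \<open>q\<close> would tend to minus infinity while the linear term has a finite slope, so a small
  move towards \<open>q\<close> would lower the objective.\<close>

lemma mirror_step_interior:
  assumes q: "q \<in> prob_simplex" "q \<in> interior Y"
  shows "mirror_step y \<in> interior Y"
proof (rule ccontr)
  define x where "x = mirror_step y"
  assume "mirror_step y \<notin> interior Y"
  then have x: "x \<in> Y" "x \<notin> interior Y"
    using mirror_step_in_simplex simplex_subset by (auto simp: x_def)
  have "\<forall>\<^sub>F u in at_right 0. grad h (x + u *\<^sub>R (q - x)) \<bullet> (q - x) < y \<bullet> (q - x)"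
    using steep_descent_from_frontier[OF x q(2)] by (auto simp: filterlim_at_bot_dense)
  then obtain b where b: "0 < b"
      "\<And>u. 0 < u \<Longrightarrow> u < b \<Longrightarrow> grad h (x + u *\<^sub>R (q - x)) \<bullet> (q - x) < y \<bullet> (q - x)"
    by (auto simp: eventually_at_right_field)
  \<comment> \<open>Halving keeps \<open>u\<close> strictly below \<open>b\<close>; the cap at 1
    keeps the point on the segment from \<open>x\<close> to \<open>q\<close>.\<close>
  define u where "u = min (b / 2) 1"
  let ?z = "x + u *\<^sub>R (q - x)"
  have u: "0 < u" "u < b" "u \<le> 1" using b by (auto simp: u_def min_def)
  have z_eq: "?z = (1 - u) *\<^sub>R x + u *\<^sub>R q" by (simp add: algebra_simps)
  have z_int: "?z \<in> interior Y"
    using mem_interior_convex_shrink[OF convex_domain q(2) x(1) u(1,3)]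
    by (simp add: algebra_simps)
  have "?z \<in> prob_simplex"
    unfolding z_eq unfolding x_def using u
    by (intro convexD_alt[OF convex_prob_simplex mirror_step_in_simplex q(1)]) auto
  then have "h x - y \<bullet> x \<le> h ?z - y \<bullet> ?z"
    unfolding x_def by (rule mirror_step_le)
  \<comment> \<open>The inequality is taken at the interior point \<open>?z\<close> and looks back
    to \<open>x\<close>, since \<open>x\<close> itself is outside the interior and its gradient
    carries no information.\<close>
  moreover have "h ?z + grad h ?z \<bullet> (x - ?z) \<le> h x"
    by (rule gradient_inequality[OF z_int x(1)])
  moreover have "grad h ?z \<bullet> (x - ?z) = - (u * (grad h ?z \<bullet> (q - x)))" by simp
  moreover have "y \<bullet> ?z = y \<bullet> x + u * (y \<bullet> (q - x))" by (simp add: inner_add_right)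
  ultimately have "u * (y \<bullet> (q - x)) \<le> u * (grad h ?z \<bullet> (q - x))" by linarith
  then have "y \<bullet> (q - x) \<le> grad h ?z \<bullet> (q - x)" using u by simp
  with b(2)[OF u(1,2)] show False by simp
qed

text \<open>First-order optimality: the one-sided derivative of the objective from the minimiser
  towards any simplex point is nonnegative.\<close>

lemma mirror_step_variational:
  assumes int: "mirror_step y \<in> interior Y" and p: "p \<in> prob_simplex"
  shows "0 \<le> (grad h (mirror_step y) - y) \<bullet> (p - mirror_step y)"
proof -
  define x where "x = mirror_step y"
  have "((\<lambda>u. h (x + u *\<^sub>R (p - x))) has_real_derivative grad h x \<bullet> (p - x)) (at 0)"
    using DERIV_along_line[of x 0 "p - x"] int by (simp add: x_def)
  then have "((\<lambda>u. (h (x + u *\<^sub>R (p - x)) - h x) / u) \<longlongrightarrow> grad h x \<bullet> (p - x)) (at_right 0)"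
    unfolding has_field_derivative_iff by (auto intro: tendsto_mono at_le)
  moreover have "\<forall>\<^sub>F u in at_right 0. y \<bullet> (p - x) \<le> (h (x + u *\<^sub>R (p - x)) - h x) / u"
    unfolding eventually_at_right_field
  proof (intro exI[of _ 1] conjI allI impI)
    fix u :: real assume u: "0 < u" "u < 1"
    have "(1 - u) *\<^sub>R x + u *\<^sub>R p \<in> prob_simplex"
      unfolding x_def using u
      by (intro convexD_alt[OF convex_prob_simplex mirror_step_in_simplex p]) auto
    then have "h x - y \<bullet> x \<le> h (x + u *\<^sub>R (p - x)) - y \<bullet> (x + u *\<^sub>R (p - x))"
      using mirror_step_le[of "(1 - u) *\<^sub>R x + u *\<^sub>R p" y] by (simp add: x_def algebra_simps)
    then have "u * (y \<bullet> (p - x)) \<le> h (x + u *\<^sub>R (p - x)) - h x"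
      by (simp add: inner_add_right)
    with u show "y \<bullet> (p - x) \<le> (h (x + u *\<^sub>R (p - x)) - h x) / u"
      by (simp add: le_divide_eq mult.commute)
  qed simp
  ultimately have "y \<bullet> (p - x) \<le> grad h x \<bullet> (p - x)"
    by (intro tendsto_lowerbound) auto
  then show ?thesis by (simp add: x_def inner_diff_left)
qed

end

section \<open>Trajectories, values and visitation\<close>

lemma prob_integrable_bounded:
  fixes g :: "'x \<Rightarrow> real"
  assumes "A \<in> space (prob_algebra M)" and g: "g \<in> borel_measurable M"
    and "\<And>x. x \<in> space M \<Longrightarrow> \<bar>g x\<bar> \<le> B"
  shows "integrable A g"
proof -
  have A: "prob_space A" "sets A = sets M"
    using assms(1) by (auto simp: space_prob_algebra)
  interpret prob_space A by fact
  show ?thesis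
    using g assms(3) sets_eq_imp_space_eq[OF A(2)]
    by (intro integrable_const_bound[where B = B] AE_I2)
       (auto simp: measurable_cong_sets[OF A(2) refl])
qed

lemma prob_abs_integral_le:
  fixes g :: "'x \<Rightarrow> real"
  assumes "A \<in> space (prob_algebra M)" and g: "g \<in> borel_measurable M"
    and "\<And>x. x \<in> space M \<Longrightarrow> \<bar>g x\<bar> \<le> B"
  shows "\<bar>\<integral>x. g x \<partial>A\<bar> \<le> B"
proof -
  have A: "prob_space A" "sets A = sets M"
    using assms(1) by (auto simp: space_prob_algebra)
  interpret prob_space A by fact
  have "\<bar>\<integral>x. g x \<partial>A\<bar> \<le> (\<integral>x. \<bar>g x\<bar> \<partial>A)"
    by (rule integral_abs_bound)
  also have "\<dots> \<le> B"
    using assms(3) sets_eq_imp_space_eq[OF A(2)] prob_integrable_bounded[OF assms]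
    by (intro integral_le_const AE_I2) auto
  finally show ?thesis .
qed

lemma integral_bind_prob_algebra:
  fixes g :: "'y \<Rightarrow> real"
  assumes A: "A \<in> space (prob_algebra M)" and K: "K \<in> M \<rightarrow>\<^sub>M prob_algebra N"
    and g: "g \<in> borel_measurable N" "\<And>x. x \<in> space N \<Longrightarrow> \<bar>g x\<bar> \<le> B"
  shows "(\<integral>y. g y \<partial>(A \<bind> K)) = (\<integral>x. (\<integral>y. g y \<partial>K x) \<partial>A)"
proof (rule integral_bind[where B' = 1, OF g])
  have A': "sets A = sets M" "prob_space A" using A by (auto simp: space_prob_algebra)
  show "K \<in> A \<rightarrow>\<^sub>M subprob_algebra N"
    using measurable_prob_algebraD[OF K] by (simp add: measurable_cong_sets[OF A'(1) refl])
  show "finite_measure A"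
    using A'(2) by (rule prob_space.finite_measure)
  show "AE x in A. emeasure (K x) (space (K x)) \<le> ennreal 1"
    using measurable_space[OF K] sets_eq_imp_space_eq[OF A'(1)]
    by (intro AE_I2) (simp add: space_prob_algebra prob_space.emeasure_space_1)
qed

lemma integrable_compose_kernel:
  fixes g :: "'y \<Rightarrow> real"
  assumes A: "A \<in> space (prob_algebra M)" and K: "K \<in> M \<rightarrow>\<^sub>M prob_algebra N"
    and g: "g \<in> borel_measurable N" "\<And>x. x \<in> space N \<Longrightarrow> \<bar>g x\<bar> \<le> B"
  shows "integrable A (\<lambda>x. \<integral>y. g y \<partial>K x)"
  by (rule prob_integrable_bounded[OF A measurable_compose[OF measurable_prob_algebraD[OF K]
          integral_measurable_subprob_algebra[OF g(1)]]])
     (rule prob_abs_integral_le[OF measurable_space[OF K] g])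

lemma bind_prob_algebra_closed:
  "A \<in> space (prob_algebra M) \<Longrightarrow> K \<in> M \<rightarrow>\<^sub>M prob_algebra N \<Longrightarrow> A \<bind> K \<in> space (prob_algebra N)"
  by (simp add: space_prob_algebra prob_space_bind' sets_bind')

lemma bind_assoc_prob_algebra:
  assumes A: "A \<in> space (prob_algebra M)" and K: "K \<in> M \<rightarrow>\<^sub>M prob_algebra N"
    and L: "L \<in> N \<rightarrow>\<^sub>M prob_algebra R"
  shows "A \<bind> K \<bind> L = A \<bind> (\<lambda>x. K x \<bind> L)"
proof -
  have "sets A = sets M" using A by (auto simp: space_prob_algebra)
  with K L show ?thesis
    by (intro bind_assoc[where N = N and R = R])
       (auto simp: measurable_cong_sets[OF \<open>sets A = sets M\<close> refl] intro: measurable_prob_algebraD)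
qed

lemma bind_cong_space:
  "A \<in> space (prob_algebra M) \<Longrightarrow> (\<And>x. x \<in> space M \<Longrightarrow> K x = L x) \<Longrightarrow> A \<bind> K = A \<bind> L"
  by (rule bind_cong) (auto simp: space_prob_algebra dest: sets_eq_imp_space_eq)

lemma return_in_prob_algebra: "x \<in> space M \<Longrightarrow> return M x \<in> space (prob_algebra M)"
  by (simp add: space_prob_algebra prob_space_return)

text \<open>The geometric majorant \<open>\<gamma> ^ t * B\<close> gives both summability conditions
  for exchanging sum and integral.\<close>

lemma integral_discounted_sum:
  fixes f :: "nat \<Rightarrow> 'x \<Rightarrow> real"
  assumes "prob_space M" and "0 \<le> \<gamma>" "\<gamma> < 1"
    and f: "\<And>t. f t \<in> borel_measurable M" "\<And>t x. x \<in> space M \<Longrightarrow> \<bar>f t x\<bar> \<le> B"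
  shows "(\<integral>x. (\<Sum>t. \<gamma> ^ t * f t x) \<partial>M) = (\<Sum>t. \<gamma> ^ t * (\<integral>x. f t x \<partial>M))"
proof -
  interpret prob_space M by fact
  have int: "integrable M (f t)" for t
    using f by (intro integrable_const_bound[where B = B] AE_I2) auto
  have geo: "summable (\<lambda>t. \<gamma> ^ t * B)"
    using assms(2,3) by (intro summable_mult2 summable_geometric) auto
  have "(\<integral>x. (\<Sum>t. \<gamma> ^ t * f t x) \<partial>M) = (\<Sum>t. \<integral>x. \<gamma> ^ t * f t x \<partial>M)"
  proof (rule integral_suminf)
    show "integrable M (\<lambda>x. \<gamma> ^ t * f t x)" for t
      using int by simp
    show "AE x in M. summable (\<lambda>t. norm (\<gamma> ^ t * f t x))"
    proof (rule AE_I2)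
      fix x assume "x \<in> space M"
      then show "summable (\<lambda>t. norm (\<gamma> ^ t * f t x))"
        using assms(2) f(2)
        by (intro summable_comparison_test'[OF geo]) (auto simp: abs_mult intro!: mult_left_mono)
    qed
    show "summable (\<lambda>t. \<integral>x. norm (\<gamma> ^ t * f t x) \<partial>M)"
    proof (rule summable_comparison_test'[OF geo])
      fix t :: nat
      have "(\<integral>x. norm (\<gamma> ^ t * f t x) \<partial>M) \<le> \<gamma> ^ t * B"
        using assms(2) f int
        by (intro integral_le_const AE_I2) (auto simp: abs_mult intro!: mult_left_mono)
      then show "norm (\<integral>x. norm (\<gamma> ^ t * f t x) \<partial>M) \<le> \<gamma> ^ t * B"
        by simp
    qed
  qed
  then show ?thesis by simp
qed

section \<open>Single-time marginals of an Ionescu-Tulcea limit\<close>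

lemma (in Ionescu_Tulcea) distr_coordinate_C:
  "distr (C 0 (Suc n) (\<lambda>_. undefined)) (M n) (\<lambda>x. x n) = C 0 n (\<lambda>_. undefined) \<bind> P n"
proof -
  let ?C = "C 0 n (\<lambda>_. undefined)"
  have u: "(\<lambda>_. undefined) \<in> space (PiM {0..<0} M)" by simp
  have sets: "sets ?C = sets (PiM {0..<n} M)" and space: "space ?C = space (PiM {0..<n} M)"
    using sets_C[OF u, of n] space_C[OF u, of n] by simp_all
  have "distr (?C \<bind> eP n) (M n) (\<lambda>x. x n) = ?C \<bind> (\<lambda>\<omega>. distr (eP n \<omega>) (M n) (\<lambda>x. x n))"
    using prob_space.not_empty[OF prob_space_C[OF u, of n]]
    by (intro distr_bind[where K = "PiM {0..<Suc n} M"]) (simp_all add: measurable_cong_sets[OF sets refl])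
  \<comment> \<open>\<open>eP n\<close> appends a draw from \<open>P n\<close> to the history, so
    reading off the new coordinate gives back \<open>P n\<close>.\<close>
  also have "\<dots> = ?C \<bind> P n"
  proof (rule bind_cong[OF refl])
    fix \<omega> assume "\<omega> \<in> space ?C"
    then have \<omega>: "\<omega> \<in> space (PiM {0..<n} M)" by (simp add: space)
    have "fun_upd \<omega> n \<in> P n \<omega> \<rightarrow>\<^sub>M PiM {0..<Suc n} M"
      using \<omega> by (intro measurable_fun_upd[where J = "{0..<n}"])
        (auto simp: measurable_cong_sets[OF sets_P[OF \<omega>] refl])
    then have "distr (eP n \<omega>) (M n) (\<lambda>x. x n) = distr (P n \<omega>) (M n) ((\<lambda>x. x n) \<circ> fun_upd \<omega> n)"
      unfolding eP_def by (intro distr_distr) simp_all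
    then show "distr (eP n \<omega>) (M n) (\<lambda>x. x n) = P n \<omega>"
      by (simp add: comp_def distr_id2 sets_P[OF \<omega>])
  qed
  finally show ?thesis by simp
qed

text \<open>Returns and visitation are sums over t of functions of one coordinate, so these
  marginals are all that is needed of the path measure. They are computed from the
  finite-dimensional law on the first \<open>Suc n\<close> coordinates.\<close>

lemma (in Ionescu_Tulcea) distr_coordinate_lim:
  "distr PF.lim (M n) (\<lambda>x. x n) = C 0 n (\<lambda>_. undefined) \<bind> P n"
proof -
  let ?J = "{0..<Suc n}"
  have up: "up_to ?J = Suc n"
    by (rule antisym) (auto simp: up_to_iff intro: up_to_less[THEN Suc_leI])
  have u: "(\<lambda>_. undefined) \<in> space (PiM {0..<0} M)" by simp
  have sets: "sets (C 0 (Suc n) (\<lambda>_. undefined)) = sets (PiM ?J M)"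
    using sets_C[OF u, of "Suc n"] by simp
  have "distr PF.lim (M n) (\<lambda>x. x n) = distr PF.lim (M n) ((\<lambda>x. x n) \<circ> (\<lambda>x. restrict x ?J))"
    by (simp add: comp_def)
  also have "\<dots> = distr (distr PF.lim (PiM ?J M) (\<lambda>x. restrict x ?J)) (M n) (\<lambda>x. x n)"
    by (rule distr_distr[symmetric])
       (auto simp: measurable_cong_sets[OF PF.sets_lim refl] intro: measurable_restrict_subset)
  also have "\<dots> = distr (distr (C 0 (Suc n) (\<lambda>_. undefined)) (PiM ?J M) (\<lambda>x. restrict x ?J)) (M n) (\<lambda>x. x n)"
    unfolding distr_lim[OF finite_atLeastLessThan] CI_def up ..
  also have "\<dots> = distr (C 0 (Suc n) (\<lambda>_. undefined)) (M n) ((\<lambda>x. x n) \<circ> (\<lambda>x. restrict x ?J))"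
    by (rule distr_distr)
       (auto simp del: C.simps simp: measurable_cong_sets[OF sets refl] intro: measurable_restrict_subset)
  also have "\<dots> = distr (C 0 (Suc n) (\<lambda>_. undefined)) (M n) (\<lambda>x. x n)"
    by (simp add: comp_def)
  finally show ?thesis unfolding distr_coordinate_C .
qed

section \<open>The state-action chain of a fixed policy\<close>

locale mdp_policy = mdp S P r \<gamma> \<mu>
  for S :: "'s measure" and P :: "'s \<times> 'a::finite \<Rightarrow> 's measure" and r \<gamma> \<mu> +
  fixes \<pi> :: "'s \<Rightarrow> real ^ 'a"
  assumes policy: "policy S \<pi>"
begin

abbreviation "Z \<equiv> state_action S :: ('s \<times> 'a) measure"
abbreviation "Q \<equiv> action_value S P r \<gamma> \<pi>"
abbreviation "V \<equiv> state_value S P r \<gamma> \<pi>"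

lemma policy_measurable [measurable]: "\<pi> \<in> borel_measurable S"
  and policy_in_simplex: "s \<in> space S \<Longrightarrow> \<pi> s \<in> prob_simplex"
  using policy by (auto simp: policy_def)

lemma policy_nonneg: "s \<in> space S \<Longrightarrow> 0 \<le> \<pi> s $ a"
  and policy_sum: "s \<in> space S \<Longrightarrow> (\<Sum>a\<in>UNIV. \<pi> s $ a) = 1"
  using policy_in_simplex by (auto simp: prob_simplex_def)

lemma policy_component_measurable [measurable]: "(\<lambda>s. \<pi> s $ a) \<in> borel_measurable S"
  using policy_measurable unfolding cart_eq_inner_axis by measurable

definition action_kernel :: "'s \<Rightarrow> ('s \<times> 'a) measure" where
  "action_kernel s = distr (point_measure UNIV (\<lambda>a. ennreal (\<pi> s $ a))) Z (Pair s)"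

lemma with_action_eq: "with_action S \<pi> N = N \<bind> action_kernel"
  by (simp add: with_action_def action_kernel_def[abs_def])

lemma Pair_measurable_point [measurable]:
  "s \<in> space S \<Longrightarrow> Pair s \<in> point_measure UNIV p \<rightarrow>\<^sub>M Z"
  by (auto simp: point_measure_def space_pair_measure)

lemma nn_integral_action_kernel:
  assumes "s \<in> space S" "g \<in> borel_measurable Z"
  shows "(\<integral>\<^sup>+z. g z \<partial>action_kernel s) = (\<Sum>a\<in>UNIV. ennreal (\<pi> s $ a) * g (s, a))"
  unfolding action_kernel_def using assms
  by (subst nn_integral_distr[OF Pair_measurable_point]) (auto simp: nn_integral_point_measure_finite)

lemma integral_action_kernel:
  fixes g :: "'s \<times> 'a \<Rightarrow> real"
  assumes "s \<in> space S" "g \<in> borel_measurable Z"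
  shows "(\<integral>z. g z \<partial>action_kernel s) = (\<Sum>a\<in>UNIV. \<pi> s $ a * g (s, a))"
  unfolding action_kernel_def using assms
  by (subst integral_distr[OF Pair_measurable_point])
     (auto simp: lebesgue_integral_point_measure_finite policy_nonneg)

lemma emeasure_action_kernel:
  assumes "s \<in> space S" "X \<in> sets Z"
  shows "emeasure (action_kernel s) X = (\<Sum>a\<in>UNIV. ennreal (\<pi> s $ a) * indicator X (s, a))"
  using nn_integral_action_kernel[OF assms(1), of "indicator X"] assms(2)
  by (simp add: action_kernel_def)

lemma action_kernel_measurable [measurable]: "action_kernel \<in> S \<rightarrow>\<^sub>M prob_algebra Z"
proof -
  have prob: "prob_space (action_kernel s)" if s: "s \<in> space S" for s
  proof
    have "emeasure (action_kernel s) (space Z) = 1"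
      using s by (simp add: emeasure_action_kernel space_pair_measure policy_nonneg sum_ennreal policy_sum)
    then show "emeasure (action_kernel s) (space (action_kernel s)) = 1"
      by (simp add: action_kernel_def)
  qed
  show ?thesis
  proof (intro measurable_prob_algebraI prob measurable_subprob_algebra)
    fix X assume [measurable]: "X \<in> sets Z"
    have "(\<lambda>s. \<Sum>a\<in>UNIV. ennreal (\<pi> s $ a) * indicator X (s, a)) \<in> borel_measurable S"
      by measurable
    then show "(\<lambda>s. emeasure (action_kernel s) X) \<in> borel_measurable S"
      by (subst measurable_cong) (auto simp: emeasure_action_kernel)
  qed (auto simp: action_kernel_def intro: prob_space_imp_subprob_space
      prob[unfolded action_kernel_def])
qed

lemma with_action_closed: "N \<in> space (prob_algebra S) \<Longrightarrow> with_action S \<pi> N \<in> space (prob_algebra Z)"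
  unfolding with_action_eq by (rule bind_prob_algebra_closed[OF _ action_kernel_measurable])

lemma with_action_return: "s \<in> space S \<Longrightarrow> with_action S \<pi> (return S s) = action_kernel s"
  unfolding with_action_eq by (rule bind_return[OF measurable_prob_algebraD[OF action_kernel_measurable]])

definition pair_kernel :: "'s \<times> 'a \<Rightarrow> ('s \<times> 'a) measure" where
  "pair_kernel z = with_action S \<pi> (P z)"

lemma transition_closed: "z \<in> space Z \<Longrightarrow> P z \<in> space (prob_algebra S)"
  using measurable_space[OF transition] .

lemma pair_kernel_measurable [measurable]: "pair_kernel \<in> Z \<rightarrow>\<^sub>M prob_algebra Z"
  unfolding pair_kernel_def[abs_def] with_action_eq
  by (rule measurable_bind_prob_space[OF transition action_kernel_measurable])

text \<open>The time-t law of the state-action chain, described without path space;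
  \<open>distr_trajectory\<close> ties it to the trajectory measure.\<close>

primrec pair_law :: "('s \<times> 'a) measure \<Rightarrow> nat \<Rightarrow> ('s \<times> 'a) measure" where
  "pair_law \<rho> 0 = \<rho>"
| "pair_law \<rho> (Suc t) = pair_law \<rho> t \<bind> pair_kernel"

lemma pair_law_closed: "\<rho> \<in> space (prob_algebra Z) \<Longrightarrow> pair_law \<rho> t \<in> space (prob_algebra Z)"
  by (induction t) (auto intro: bind_prob_algebra_closed[OF _ pair_kernel_measurable])

text \<open>The recursion peels off the last transition; the Bellman equation needs the first one
  peeled off.\<close>

lemma pair_law_Suc_shift: "pair_law \<rho> (Suc t) = pair_law (\<rho> \<bind> pair_kernel) t"
  by (induction t) auto

lemma pair_law_return_measurable [measurable]:
  "(\<lambda>z. pair_law (return Z z) t) \<in> Z \<rightarrow>\<^sub>M prob_algebra Z"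
proof (induction t)
  case 0
  show ?case using measurable_return_prob_space[of Z] by simp
next
  case (Suc t)
  show ?case using measurable_bind_prob_space[OF Suc pair_kernel_measurable] by simp
qed

text \<open>Conditioning on the first pair. It reduces statements about a general initial law to
  point masses.\<close>

lemma pair_law_mixture:
  assumes "\<rho> \<in> space (prob_algebra Z)"
  shows "pair_law \<rho> t = \<rho> \<bind> (\<lambda>z. pair_law (return Z z) t)"
proof (induction t)
  case 0
  then show ?case
    using assms by (simp add: bind_return'' space_prob_algebra)
next
  case (Suc t)
  then show ?case
    using bind_assoc_prob_algebra[OF assms pair_law_return_measurable pair_kernel_measurable, of t]
    by simp
qed

lemma Ionescu_Tulcea_trajectory:
  assumes \<rho>: "\<rho> \<in> space (prob_algebra Z)"
  shows "Ionescu_Tulcea (trajectory_kernel S P \<pi> \<rho>) (\<lambda>_. Z)"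
proof -
  have K: "trajectory_kernel S P \<pi> \<rho> n \<in> PiM {0..<n} (\<lambda>_. Z) \<rightarrow>\<^sub>M prob_algebra Z" for n
  proof (cases n)
    case 0
    with \<rho> show ?thesis by (simp add: trajectory_kernel_def[abs_def])
  next
    case (Suc m)
    then show ?thesis
      using measurable_compose[OF measurable_component_singleton[of m "{0..<n}" "\<lambda>_. Z"]
          pair_kernel_measurable]
      by (simp add: trajectory_kernel_def[abs_def] pair_kernel_def)
  qed
  show ?thesis
  proof (rule Ionescu_Tulcea.intro)
    fix n :: nat
    show "trajectory_kernel S P \<pi> \<rho> n \<in> PiM {0..<n} (\<lambda>_. Z) \<rightarrow>\<^sub>M subprob_algebra Z"
      by (rule measurable_prob_algebraD[OF K])
    fix x assume "x \<in> space (PiM {0..<n} (\<lambda>_. Z))"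
    then show "prob_space (trajectory_kernel S P \<pi> \<rho> n x)"
      using measurable_space[OF K] by (simp add: space_prob_algebra)
  qed
qed

text \<open>The kernel at time \<open>Suc t\<close> sees the history only through its last
  coordinate, so the law of that coordinate, known by induction, determines the next one.\<close>

lemma distr_trajectory:
  assumes \<rho>: "\<rho> \<in> space (prob_algebra Z)"
  shows "distr (trajectory S P \<pi> \<rho>) Z (\<lambda>x. x t) = pair_law \<rho> t"
proof -
  interpret IT: Ionescu_Tulcea "trajectory_kernel S P \<pi> \<rho>" "\<lambda>_. Z"
    by (rule Ionescu_Tulcea_trajectory[OF \<rho>])
  have "IT.C 0 t (\<lambda>_. undefined) \<bind> trajectory_kernel S P \<pi> \<rho> t = pair_law \<rho> t"
  proof (induction t)
    case 0
    have "return (PiM {0..<0} (\<lambda>_. Z)) (\<lambda>_. undefined) \<bind> trajectory_kernel S P \<pi> \<rho> 0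
        = trajectory_kernel S P \<pi> \<rho> 0 (\<lambda>_. undefined)"
      by (rule bind_return[OF IT.P]) simp
    also have "\<dots> = \<rho>" by (simp add: trajectory_kernel_def)
    finally show ?case by simp
  next
    case (Suc t)
    have u: "(\<lambda>_. undefined) \<in> space (PiM {0..<0::nat} (\<lambda>_. Z))" by simp
    have sets: "sets (IT.C 0 (Suc t) (\<lambda>_. undefined)) = sets (PiM {0..<Suc t} (\<lambda>_. Z))"
      using IT.sets_C[OF u, of "Suc t"] by simp
    have "IT.C 0 (Suc t) (\<lambda>_. undefined) \<bind> trajectory_kernel S P \<pi> \<rho> (Suc t)
        = IT.C 0 (Suc t) (\<lambda>_. undefined) \<bind> (\<lambda>x. pair_kernel (x t))"
      by (simp add: trajectory_kernel_def[abs_def] pair_kernel_def del: IT.C.simps)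
    also have "\<dots> = distr (IT.C 0 (Suc t) (\<lambda>_. undefined)) Z (\<lambda>x. x t) \<bind> pair_kernel"
      by (rule bind_distr[OF _ measurable_prob_algebraD[OF pair_kernel_measurable], symmetric])
         (simp_all add: measurable_cong_sets[OF sets refl] prob_space.not_empty[OF IT.prob_space_C[OF u]]
           del: IT.C.simps)
    also have "\<dots> = pair_law \<rho> (Suc t)"
      unfolding IT.distr_coordinate_C Suc.IH by simp
    finally show ?case .
  qed
  then show ?thesis
    unfolding trajectory_def using IT.distr_coordinate_lim[of t] by simp
qed

lemma
  assumes \<rho>: "\<rho> \<in> space (prob_algebra Z)"
  shows prob_space_trajectory: "prob_space (trajectory S P \<pi> \<rho>)"
    and coordinate_measurable: "(\<lambda>x. x t) \<in> trajectory S P \<pi> \<rho> \<rightarrow>\<^sub>M Z"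
proof -
  interpret IT: Ionescu_Tulcea "trajectory_kernel S P \<pi> \<rho>" "\<lambda>_. Z"
    by (rule Ionescu_Tulcea_trajectory[OF \<rho>])
  have eq: "trajectory S P \<pi> \<rho> = IT.PF.lim" by (simp add: trajectory_def)
  have meas: "(\<lambda>x. x t) \<in> trajectory S P \<pi> \<rho> \<rightarrow>\<^sub>M Z" for t
    unfolding eq by (simp add: measurable_cong_sets[OF IT.PF.sets_lim refl])
  then show "(\<lambda>x. x t) \<in> trajectory S P \<pi> \<rho> \<rightarrow>\<^sub>M Z" .
  \<comment> \<open>The total mass of the path measure is read off its time-0 marginal, which is
    \<open>\<rho>\<close>.\<close>
  have "prob_space (distr (trajectory S P \<pi> \<rho>) Z (\<lambda>x. x 0))"
    unfolding distr_trajectory[OF \<rho>] using \<rho> by (simp add: space_prob_algebra)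
  then show "prob_space (trajectory S P \<pi> \<rho>)"
    by (rule prob_space_distrD[OF meas])
qed

section \<open>Values and the Bellman equation\<close>

definition return_of :: "('s \<times> 'a) measure \<Rightarrow> real" where
  "return_of \<rho> = (\<Sum>t. \<gamma> ^ t * (\<integral>z. r z \<partial>pair_law \<rho> t))"

lemma reward_abs: "z \<in> space Z \<Longrightarrow> \<bar>r z\<bar> \<le> 1"
  using reward_bounds[of z] by auto

text \<open>\<open>Q\<close>, \<open>V\<close> and the value at \<open>\<mu>\<close> differ only in
  the initial law: a point mass, an action kernel, or \<open>with_action S \<pi> \<mu>\<close>. All
  three become instances of \<open>return_of\<close>.\<close>

lemma integral_trajectory:
  assumes \<rho>: "\<rho> \<in> space (prob_algebra Z)"
  shows "(\<integral>x. (\<Sum>t. \<gamma> ^ t * r (x t)) \<partial>trajectory S P \<pi> \<rho>) = return_of \<rho>"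
proof -
  note meas = coordinate_measurable[OF \<rho>]
  have "(\<integral>x. (\<Sum>t. \<gamma> ^ t * r (x t)) \<partial>trajectory S P \<pi> \<rho>)
      = (\<Sum>t. \<gamma> ^ t * (\<integral>x. r (x t) \<partial>trajectory S P \<pi> \<rho>))"
    by (rule integral_discounted_sum[OF prob_space_trajectory[OF \<rho>] discount
          measurable_compose[OF meas reward_measurable] reward_abs[OF measurable_space[OF meas]]])
  also have "\<dots> = return_of \<rho>"
    unfolding return_of_def distr_trajectory[OF \<rho>, symmetric]
    by (simp add: integral_distr[OF meas reward_measurable])
  finally show ?thesis .
qed

lemma action_value_eq: "z \<in> space Z \<Longrightarrow> Q z = return_of (return Z z)"
  unfolding action_value_def by (rule integral_trajectory[OF return_in_prob_algebra])

lemma state_value_eq: "s \<in> space S \<Longrightarrow> V s = return_of (action_kernel s)"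
  unfolding state_value_def trajectory_from_def with_action_return
  by (rule integral_trajectory[OF measurable_space[OF action_kernel_measurable]])

lemma reward_law_measurable [measurable]:
  "(\<lambda>z. \<integral>y. r y \<partial>pair_law (return Z z) t) \<in> borel_measurable Z"
  by (rule measurable_compose[OF measurable_prob_algebraD[OF pair_law_return_measurable]
        integral_measurable_subprob_algebra[OF reward_measurable]])

lemma reward_law_bound:
  "\<rho> \<in> space (prob_algebra Z) \<Longrightarrow> \<bar>\<integral>y. r y \<partial>pair_law \<rho> t\<bar> \<le> 1"
  by (rule prob_abs_integral_le[OF pair_law_closed reward_measurable reward_abs])

lemma action_value_measurable [measurable]: "Q \<in> borel_measurable Z"
proof -
  have "(\<lambda>z. return_of (return Z z)) \<in> borel_measurable Z"
    unfolding return_of_def by (intro borel_measurable_suminf) measurable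
  then show ?thesis
    by (subst measurable_cong[OF action_value_eq])
qed

lemma summable_discounted:
  assumes "\<And>t. \<bar>c t\<bar> \<le> (B :: real)"
  shows "summable (\<lambda>t. \<gamma> ^ t * c t)"
proof (rule summable_comparison_test')
  show "summable (\<lambda>t. \<gamma> ^ t * B)"
    using discount by (intro summable_mult2 summable_geometric) auto
  show "norm (\<gamma> ^ t * c t) \<le> \<gamma> ^ t * B" for t
    using assms discount by (auto simp: abs_mult intro!: mult_left_mono)
qed

lemma return_of_bound:
  assumes \<rho>: "\<rho> \<in> space (prob_algebra Z)"
  shows "\<bar>return_of \<rho>\<bar> \<le> 1 / (1 - \<gamma>)"
proof -
  have abs: "\<bar>\<gamma> ^ t * (\<integral>y. r y \<partial>pair_law \<rho> t)\<bar> \<le> \<gamma> ^ t" for t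
    using reward_law_bound[OF \<rho>, of t] discount by (simp add: abs_mult mult_left_le)
  have geo: "summable (\<lambda>t. \<gamma> ^ t)"
    using discount by (intro summable_geometric) auto
  have "\<bar>return_of \<rho>\<bar> \<le> (\<Sum>t. \<gamma> ^ t)"
    unfolding return_of_def real_norm_def[symmetric]
    by (rule norm_suminf_le[OF _ geo]) (simp only: real_norm_def abs)
  also have "\<dots> = 1 / (1 - \<gamma>)"
    using discount by (intro suminf_geometric) auto
  finally show ?thesis .
qed

lemma action_value_bound: "z \<in> space Z \<Longrightarrow> \<bar>Q z\<bar> \<le> 1 / (1 - \<gamma>)"
  by (simp add: action_value_eq return_of_bound return_in_prob_algebra)

text \<open>Conditioning on the first pair turns each summand into an average over
  \<open>\<rho>\<close>; the discounted sum inside that average is \<open>Q\<close>.\<close>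

lemma return_of_eq_integral:
  assumes \<rho>: "\<rho> \<in> space (prob_algebra Z)"
  shows "return_of \<rho> = (\<integral>z. Q z \<partial>\<rho>)"
proof -
  have \<rho>': "sets \<rho> = sets Z" "prob_space \<rho>" using \<rho> by (auto simp: space_prob_algebra)
  have "(\<integral>z. Q z \<partial>\<rho>) = (\<integral>z. (\<Sum>t. \<gamma> ^ t * (\<integral>y. r y \<partial>pair_law (return Z z) t)) \<partial>\<rho>)"
    by (rule Bochner_Integration.integral_cong)
       (simp_all add: action_value_eq return_of_def sets_eq_imp_space_eq[OF \<rho>'(1)])
  also have "\<dots> = (\<Sum>t. \<gamma> ^ t * (\<integral>z. (\<integral>y. r y \<partial>pair_law (return Z z) t) \<partial>\<rho>))"
    using reward_law_bound[OF return_in_prob_algebra] sets_eq_imp_space_eq[OF \<rho>'(1)]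
    by (intro integral_discounted_sum[OF \<rho>'(2) discount, of _ 1])
       (auto simp: measurable_cong_sets[OF \<rho>'(1) refl])
  also have "\<dots> = return_of \<rho>"
    unfolding return_of_def
    by (subst pair_law_mixture[OF \<rho>])
       (simp add: integral_bind_prob_algebra[OF \<rho> pair_law_return_measurable reward_measurable reward_abs])
  finally show ?thesis ..
qed

lemma state_value_sum: "s \<in> space S \<Longrightarrow> V s = (\<Sum>a\<in>UNIV. \<pi> s $ a * Q (s, a))"
  using measurable_space[OF action_kernel_measurable]
  by (simp add: state_value_eq return_of_eq_integral integral_action_kernel)

lemma state_value_integral: "s \<in> space S \<Longrightarrow> V s = (\<integral>z. Q z \<partial>action_kernel s)"
  by (simp add: state_value_sum integral_action_kernel)

lemma state_value_measurable [measurable]: "V \<in> borel_measurable S"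
  by (subst measurable_cong[OF state_value_sum]) measurable

lemma state_value_bound: "s \<in> space S \<Longrightarrow> \<bar>V s\<bar> \<le> 1 / (1 - \<gamma>)"
  using measurable_space[OF action_kernel_measurable]
  by (simp add: state_value_eq return_of_bound)

lemma integral_with_action:
  assumes "N \<in> space (prob_algebra S)"
  shows "(\<integral>z. Q z \<partial>with_action S \<pi> N) = (\<integral>s. V s \<partial>N)"
proof -
  have N: "space N = space S"
    using assms by (auto simp: space_prob_algebra dest: sets_eq_imp_space_eq)
  have "(\<integral>z. Q z \<partial>with_action S \<pi> N) = (\<integral>s. (\<integral>z. Q z \<partial>action_kernel s) \<partial>N)"
    unfolding with_action_eq
    by (rule integral_bind_prob_algebra[OF assms action_kernel_measurable
          action_value_measurable action_value_bound])
  also have "\<dots> = (\<integral>s. V s \<partial>N)"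
    by (rule Bochner_Integration.integral_cong) (simp_all add: N state_value_integral)
  finally show ?thesis .
qed

lemma start_value_eq: "start_value S P r \<gamma> \<mu> \<pi> = return_of (with_action S \<pi> \<mu>)"
  unfolding start_value_def
  by (simp add: return_of_eq_integral with_action_closed initial integral_with_action)

text \<open>The time-0 term is the reward. By the shift, the remaining terms are \<gamma> times the
  return of the chain started from \<open>pair_kernel z\<close>, and that return is the mean of
  \<open>V\<close> under \<open>P z\<close>.\<close>

lemma Bellman:
  assumes z: "z \<in> space Z"
  shows "Q z = r z + \<gamma> * (\<integral>s. V s \<partial>P z)"
proof -
  let ?a = "\<lambda>t. \<integral>y. r y \<partial>pair_law (return Z z) t"
  have K: "return Z z \<bind> pair_kernel = pair_kernel z"
    by (rule bind_return[OF measurable_prob_algebraD[OF pair_kernel_measurable] z])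
  have "Q z = (\<Sum>t. \<gamma> ^ t * ?a t)"
    using z by (simp add: action_value_eq return_of_def)
  also have "\<dots> = ?a 0 + (\<Sum>t. \<gamma> ^ Suc t * ?a (Suc t))"
    using suminf_split_head[OF summable_discounted[of ?a 1]] z
    by (simp add: reward_law_bound return_in_prob_algebra del: pair_law.simps(2))
  also have "(\<Sum>t. \<gamma> ^ Suc t * ?a (Suc t)) = (\<Sum>t. \<gamma> * (\<gamma> ^ t * (\<integral>y. r y \<partial>pair_law (pair_kernel z) t)))"
    unfolding pair_law_Suc_shift K by (simp add: mult.assoc)
  also have "\<dots> = \<gamma> * return_of (pair_kernel z)"
    unfolding return_of_def
    by (rule suminf_mult[OF summable_discounted[of _ 1]])
       (rule reward_law_bound[OF measurable_space[OF pair_kernel_measurable z]])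
  also have "return_of (pair_kernel z) = (\<integral>s. V s \<partial>P z)"
    using measurable_space[OF pair_kernel_measurable z]
    by (simp add: return_of_eq_integral) (simp add: pair_kernel_def integral_with_action transition_closed z)
  also have "?a 0 = r z"
    using z reward_measurable by (simp add: integral_return)
  finally show ?thesis .
qed

section \<open>State laws and the visitation distribution\<close>

primrec state_law :: "nat \<Rightarrow> 's measure" where
  "state_law 0 = \<mu>"
| "state_law (Suc t) = with_action S \<pi> (state_law t) \<bind> P"

lemma state_law_closed: "state_law t \<in> space (prob_algebra S)"
  by (induction t) (auto intro: initial bind_prob_algebra_closed[OF with_action_closed transition])

lemma pair_law_with_action: "pair_law (with_action S \<pi> \<mu>) t = with_action S \<pi> (state_law t)"
proof (induction t)
  case (Suc t)
  have "with_action S \<pi> (state_law t) \<bind> pair_kernel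
      = with_action S \<pi> (state_law t) \<bind> (\<lambda>z. P z \<bind> action_kernel)"
    by (simp add: pair_kernel_def[abs_def] with_action_eq)
  also have "\<dots> = with_action S \<pi> (state_law t) \<bind> P \<bind> action_kernel"
    by (rule bind_assoc_prob_algebra[symmetric, OF with_action_closed[OF state_law_closed]
          transition action_kernel_measurable])
  finally show ?case using Suc by (simp add: with_action_eq)
qed simp

lemma distr_fst_with_action:
  assumes N: "N \<in> space (prob_algebra S)"
  shows "distr (with_action S \<pi> N) S fst = N"
proof -
  have N': "sets N = sets S" "prob_space N" using N by (auto simp: space_prob_algebra)
  have K: "action_kernel \<in> N \<rightarrow>\<^sub>M subprob_algebra Z"
    using measurable_prob_algebraD[OF action_kernel_measurable]
    by (simp add: measurable_cong_sets[OF N'(1) refl])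
  have "distr (with_action S \<pi> N) S fst = N \<bind> (\<lambda>s. distr (action_kernel s) S fst)"
    unfolding with_action_eq
    by (rule distr_bind[OF K prob_space.not_empty[OF N'(2)] measurable_fst])
  also have "\<dots> = N \<bind> return S"
  proof (rule bind_cong_space[OF N])
    fix s assume s: "s \<in> space S"
    show "distr (action_kernel s) S fst = return S s"
    proof (rule measure_eqI)
      fix B assume "B \<in> sets (distr (action_kernel s) S fst)"
      then have B[measurable]: "B \<in> sets S" by simp
      have sets: "sets (action_kernel s) = sets Z" by (simp add: action_kernel_def)
      have "emeasure (distr (action_kernel s) S fst) B = (\<integral>\<^sup>+z. indicator B (fst z) \<partial>action_kernel s)"
        by (subst nn_integral_distr[symmetric]) (auto simp: measurable_cong_sets[OF sets refl])
      also have "\<dots> = indicator B s"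
        using s by (simp add: nn_integral_action_kernel sum_distrib_right[symmetric] sum_ennreal
            policy_nonneg policy_sum)
      finally show "emeasure (distr (action_kernel s) S fst) B = emeasure (return S s) B"
        using B by simp
    qed simp
  qed
  also have "\<dots> = N" by (rule bind_return''[OF N'(1)])
  finally show ?thesis .
qed

lemma emeasure_trajectory_state:
  assumes \<rho>: "\<rho> \<in> space (prob_algebra Z)" and B: "B \<in> sets S"
  shows "emeasure (trajectory S P \<pi> \<rho>) {x \<in> space (trajectory S P \<pi> \<rho>). fst (x t) \<in> B}
    = emeasure (pair_law \<rho> t) (fst -` B \<inter> space Z)"
  unfolding distr_trajectory[OF \<rho>, symmetric]
  using B measurable_space[OF coordinate_measurable[OF \<rho>]] measurable_sets[OF measurable_fst B]
  by (subst emeasure_distr[OF coordinate_measurable[OF \<rho>]])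
     (auto intro!: arg_cong[where f = "emeasure _"])

text \<open>Here the initial law varies with the state; \<open>pair_law_mixture\<close> reduces
  measurability to point-mass starts.\<close>

lemma pair_law_action_kernel_measurable [measurable]:
  "(\<lambda>s. pair_law (action_kernel s) t) \<in> S \<rightarrow>\<^sub>M prob_algebra Z"
proof -
  have "(\<lambda>s. action_kernel s \<bind> (\<lambda>z. pair_law (return Z z) t)) \<in> S \<rightarrow>\<^sub>M prob_algebra Z"
    by (rule measurable_bind_prob_space[OF action_kernel_measurable pair_law_return_measurable])
  then show ?thesis
    by (subst measurable_cong[OF pair_law_mixture[OF measurable_space[OF action_kernel_measurable]]])
qed

lemma emeasure_trajectory_from:
  "s \<in> space S \<Longrightarrow> B \<in> sets S \<Longrightarrow>
    emeasure (trajectory_from S P \<pi> s) {x \<in> space (trajectory_from S P \<pi> s). fst (x t) \<in> B}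
      = emeasure (pair_law (action_kernel s) t) (fst -` B \<inter> space Z)"
  by (simp add: trajectory_from_def with_action_return emeasure_trajectory_state
      measurable_space[OF action_kernel_measurable])

lemma initial_sets: "sets \<mu> = sets S" and initial_space: "space \<mu> = space S"
  using initial by (auto simp: space_prob_algebra dest: sets_eq_imp_space_eq)

lemma emeasure_trajectory_from_measurable:
  assumes B: "B \<in> sets S"
  shows "(\<lambda>s. emeasure (trajectory_from S P \<pi> s)
    {x \<in> space (trajectory_from S P \<pi> s). fst (x t) \<in> B}) \<in> borel_measurable \<mu>"
proof -
  have "(\<lambda>s. emeasure (pair_law (action_kernel s) t) (fst -` B \<inter> space Z)) \<in> borel_measurable S"
    by (rule measurable_compose[OF measurable_prob_algebraD[OF pair_law_action_kernel_measurable]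
          measurable_emeasure_subprob_algebra[OF measurable_sets[OF measurable_fst B]]])
  then show ?thesis
    unfolding measurable_cong_sets[OF initial_sets refl]
    by (subst measurable_cong[OF emeasure_trajectory_from[OF _ B]])
qed

text \<open>Averaging over the start state commutes with running the chain, by associativity of
  bind; dropping the action at time t then leaves \<open>state_law t\<close>. This removes
  trajectories from the definition of visitation.\<close>

lemma emeasure_state_law:
  assumes B: "B \<in> sets S"
  shows "(\<integral>\<^sup>+s. emeasure (trajectory_from S P \<pi> s)
      {x \<in> space (trajectory_from S P \<pi> s). fst (x t) \<in> B} \<partial>\<mu>) = emeasure (state_law t) B"
proof -
  let ?X = "fst -` B \<inter> space Z"
  have X: "?X \<in> sets Z" using measurable_sets[OF measurable_fst B] .
  have "(\<integral>\<^sup>+s. emeasure (trajectory_from S P \<pi> s)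
      {x \<in> space (trajectory_from S P \<pi> s). fst (x t) \<in> B} \<partial>\<mu>)
      = (\<integral>\<^sup>+s. emeasure (pair_law (action_kernel s) t) ?X \<partial>\<mu>)"
    by (rule nn_integral_cong) (simp add: initial_space emeasure_trajectory_from B)
  also have "\<dots> = emeasure (\<mu> \<bind> (\<lambda>s. pair_law (action_kernel s) t)) ?X"
    by (rule emeasure_bind_prob_algebra[OF initial pair_law_action_kernel_measurable X, symmetric])
  also have "\<mu> \<bind> (\<lambda>s. pair_law (action_kernel s) t)
      = \<mu> \<bind> (\<lambda>s. action_kernel s \<bind> (\<lambda>z. pair_law (return Z z) t))"
    by (rule bind_cong_space[OF initial pair_law_mixture[OF measurable_space[OF action_kernel_measurable]]])
  also have "\<dots> = pair_law (with_action S \<pi> \<mu>) t"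
    unfolding with_action_eq
    by (subst pair_law_mixture[OF with_action_closed[OF initial, unfolded with_action_eq]])
       (rule bind_assoc_prob_algebra[symmetric, OF initial action_kernel_measurable pair_law_return_measurable])
  also have "emeasure \<dots> ?X = emeasure (distr (with_action S \<pi> (state_law t)) S fst) B"
  proof -
    have sets: "sets (with_action S \<pi> (state_law t)) = sets Z"
      using with_action_closed[OF state_law_closed] by (simp add: space_prob_algebra)
    show ?thesis
      unfolding pair_law_with_action
      by (subst emeasure_distr)
         (auto simp: B measurable_cong_sets[OF sets refl] sets_eq_imp_space_eq[OF sets])
  qed
  finally show ?thesis by (simp add: distr_fst_with_action state_law_closed)
qed

text \<open>The visitation distribution is the law of the state at an independent geometric time.\<close>

lemma visitation_eq_bind: "visitation S P \<gamma> \<mu> \<pi> = measure_pmf (geometric_pmf (1 - \<gamma>)) \<bind> state_law"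
proof -
  let ?G = "measure_pmf (geometric_pmf (1 - \<gamma>)) \<bind> state_law"
  have law: "state_law \<in> count_space UNIV \<rightarrow>\<^sub>M prob_algebra S"
    using state_law_closed by simp
  have G: "measure_pmf (geometric_pmf (1 - \<gamma>)) \<in> space (prob_algebra (count_space UNIV))"
    by (simp add: space_prob_algebra measure_pmf.prob_space_axioms)
  have sets: "sets ?G = sets S" by (rule sets_bind'[OF G law])
  have "visitation S P \<gamma> \<mu> \<pi> = measure_of (space S) (sets S) (emeasure ?G)"
    unfolding visitation_def
  proof (rule measure_of_eq[OF sets.space_closed])
    fix B assume "B \<in> sigma_sets (space S) (sets S)"
    then have B: "B \<in> sets S" by (simp add: sets.sigma_sets_eq)
    have "emeasure ?G B = (\<Sum>t. ennreal (\<gamma> ^ t * (1 - \<gamma>)) * emeasure (state_law t) B)"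
      unfolding emeasure_bind_prob_algebra[OF G law B] nn_integral_measure_pmf nn_integral_count_space_nat
      using discount by simp
    also have "\<dots> = (\<Sum>t. ennreal (1 - \<gamma>) * (ennreal (\<gamma> ^ t) * emeasure (state_law t) B))"
      using discount by (simp add: ennreal_mult mult_ac)
    also have "\<dots> = ennreal (1 - \<gamma>) * (\<Sum>t. ennreal (\<gamma> ^ t) * emeasure (state_law t) B)"
      by (rule ennreal_suminf_cmult)
    also have "(\<Sum>t. ennreal (\<gamma> ^ t) * emeasure (state_law t) B)
       = (\<integral>\<^sup>+s\<^sub>0. (\<Sum>t. ennreal (\<gamma> ^ t) * emeasure (trajectory_from S P \<pi> s\<^sub>0)
          {x \<in> space (trajectory_from S P \<pi> s\<^sub>0). fst (x t) \<in> B}) \<partial>\<mu>)"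
      using emeasure_trajectory_from_measurable[OF B]
      by (subst nn_integral_suminf)
         (simp_all add: nn_integral_cmult emeasure_state_law[OF B] borel_measurable_times_ennreal)
    finally show "ennreal (1 - \<gamma>) * (\<integral>\<^sup>+s\<^sub>0. (\<Sum>t. ennreal (\<gamma> ^ t) *
        emeasure (trajectory_from S P \<pi> s\<^sub>0)
          {x \<in> space (trajectory_from S P \<pi> s\<^sub>0). fst (x t) \<in> B}) \<partial>\<mu>) = emeasure ?G B" by simp
  qed
  also have "\<dots> = ?G"
    using measure_of_of_measure[of ?G] sets sets_eq_imp_space_eq[OF sets] by simp
  finally show ?thesis .
qed

lemma visitation_closed: "visitation S P \<gamma> \<mu> \<pi> \<in> space (prob_algebra S)"
  unfolding visitation_eq_bind
  by (rule bind_prob_algebra_closed[where M = "count_space UNIV"])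
     (simp_all add: space_prob_algebra measure_pmf.prob_space_axioms
       state_law_closed[unfolded space_prob_algebra, simplified])

lemma integral_visitation:
  fixes g :: "'s \<Rightarrow> real"
  assumes g: "g \<in> borel_measurable S" "\<And>s. s \<in> space S \<Longrightarrow> \<bar>g s\<bar> \<le> B"
  shows "(\<lambda>t. (1 - \<gamma>) * \<gamma> ^ t * (\<integral>s. g s \<partial>state_law t)) sums (\<integral>s. g s \<partial>visitation S P \<gamma> \<mu> \<pi>)"
proof -
  let ?G = "measure_pmf (geometric_pmf (1 - \<gamma>))"
  let ?c = "\<lambda>t. \<integral>s. g s \<partial>state_law t"
  have law: "state_law \<in> count_space UNIV \<rightarrow>\<^sub>M prob_algebra S"
    using state_law_closed by simp
  have G: "?G \<in> space (prob_algebra (count_space UNIV))"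
    by (simp add: space_prob_algebra measure_pmf.prob_space_axioms)
  have eq: "(\<integral>s. g s \<partial>visitation S P \<gamma> \<mu> \<pi>) = (\<integral>t. ?c t \<partial>?G)"
    unfolding visitation_eq_bind by (rule integral_bind_prob_algebra[OF G law g])
  have "integrable ?G ?c"
    by (rule integrable_compose_kernel[OF G law g])
  \<comment> \<open>Seen as a density over counting measure, the geometric law turns an expectation
    over the random time into a series.\<close>
  then have int: "integrable (count_space UNIV) (\<lambda>t. pmf (geometric_pmf (1 - \<gamma>)) t *\<^sub>R ?c t)"
    unfolding measure_pmf_eq_density by (subst (asm) integrable_density) auto
  have "(\<integral>t. ?c t \<partial>?G) = (\<integral>t. pmf (geometric_pmf (1 - \<gamma>)) t *\<^sub>R ?c t \<partial>count_space UNIV)"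
    unfolding measure_pmf_eq_density by (subst integral_density) auto
  with sums_integral_count_space_nat[OF int] discount show ?thesis
    unfolding eq by (simp add: mult_ac)
qed

end

section \<open>Comparing the values of two policies\<close>

lemma (in mdp_policy) start_value_bound: "\<bar>start_value S P r \<gamma> \<mu> \<pi>\<bar> \<le> 1 / (1 - \<gamma>)"
  unfolding start_value_eq by (rule return_of_bound[OF with_action_closed[OF initial]])

text \<open>Let c(t) be the mean of the old value function under the time-t state law of the new
  policy. By Bellman, the mean advantage at time t is the expected reward plus \<gamma> c(t+1) -
  c(t). Discounting by \<gamma>^t sums the rewards to the new value and makes the rest
  telescope.\<close>

lemma (in mdp_policy) performance_difference:
  assumes \<pi>': "policy S \<pi>'"
  shows "(\<integral>s. (\<Sum>a\<in>UNIV. (\<pi>' s $ a - \<pi> s $ a) * Q (s, a)) \<partial>visitation S P \<gamma> \<mu> \<pi>')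
    = (1 - \<gamma>) * (start_value S P r \<gamma> \<mu> \<pi>' - start_value S P r \<gamma> \<mu> \<pi>)"
proof -
  interpret new: mdp_policy S P r \<gamma> \<mu> \<pi>'
    by unfold_locales (rule \<pi>')
  define B where "B = 1 / (1 - \<gamma>)"
  let ?N = new.state_law
  let ?c = "\<lambda>t. \<integral>s. V s \<partial>?N t"
  let ?\<rho> = "\<lambda>t. with_action S \<pi>' (?N t)"
  let ?A = "\<lambda>s. \<integral>z. Q z \<partial>new.action_kernel s"
  let ?g = "\<lambda>s. ?A s - V s"
  note N = new.state_law_closed
  note \<rho> = new.with_action_closed[OF N]
  note Vb = state_value_measurable state_value_bound and Qb = action_value_measurable action_value_bound
  have A_meas: "?A \<in> borel_measurable S"
    by (rule measurable_compose[OF measurable_prob_algebraD[OF new.action_kernel_measurable]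
          integral_measurable_subprob_algebra[OF action_value_measurable]])
  have A_bound: "\<bar>?A s\<bar> \<le> B" if "s \<in> space S" for s
    unfolding B_def
    by (rule prob_abs_integral_le[OF measurable_space[OF new.action_kernel_measurable that] Qb])
  have step: "(\<integral>s. ?g s \<partial>?N t) = (\<integral>z. r z \<partial>?\<rho> t) + \<gamma> * ?c (Suc t) - ?c t" for t
  proof -
    have sets: "space (?\<rho> t) = space Z"
      using \<rho>[of t] by (auto simp: space_prob_algebra dest: sets_eq_imp_space_eq)
    have "(\<integral>s. ?g s \<partial>?N t) = (\<integral>s. ?A s \<partial>?N t) - ?c t"
      by (rule Bochner_Integration.integral_diff[OF prob_integrable_bounded[OF N A_meas A_bound]
            prob_integrable_bounded[OF N Vb]])
    also have "(\<integral>s. ?A s \<partial>?N t) = (\<integral>z. Q z \<partial>?\<rho> t)"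
      unfolding new.with_action_eq
      by (rule integral_bind_prob_algebra[symmetric, OF N new.action_kernel_measurable Qb])
    also have "\<dots> = (\<integral>z. r z + \<gamma> * (\<integral>s. V s \<partial>P z) \<partial>?\<rho> t)"
      by (rule Bochner_Integration.integral_cong) (auto simp: sets Bellman)
    also have "\<dots> = (\<integral>z. r z \<partial>?\<rho> t) + (\<integral>z. \<gamma> * (\<integral>s. V s \<partial>P z) \<partial>?\<rho> t)"
      by (rule Bochner_Integration.integral_add[OF
            prob_integrable_bounded[OF \<rho> reward_measurable reward_abs]
            integrable_mult_right[OF integrable_compose_kernel[OF \<rho> transition Vb]]])
    also have "(\<integral>z. \<gamma> * (\<integral>s. V s \<partial>P z) \<partial>?\<rho> t) = \<gamma> * ?c (Suc t)"
      using integral_bind_prob_algebra[OF \<rho> transition Vb, of t] by simp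
    finally show ?thesis .
  qed
  have c_bound: "\<bar>?c t\<bar> \<le> B" for t
    unfolding B_def by (rule prob_abs_integral_le[OF N Vb])
  have rew: "(\<lambda>t. \<gamma> ^ t * (\<integral>z. r z \<partial>?\<rho> t)) sums start_value S P r \<gamma> \<mu> \<pi>'"
    unfolding new.start_value_eq new.return_of_def new.pair_law_with_action
    by (rule summable_sums[OF summable_discounted[OF prob_abs_integral_le[OF \<rho> reward_measurable reward_abs]]])
  have "(\<lambda>t. \<gamma> ^ t * ?c t) \<longlonglongrightarrow> 0"
    by (rule summable_LIMSEQ_zero[OF summable_discounted[OF c_bound]])
  \<comment> \<open>Only minus the time-0 term survives; both policies start from
    \<open>\<mu>\<close>, so it is the old start value.\<close>
  from telescope_sums[OF this] have tele:
    "(\<lambda>t. \<gamma> ^ Suc t * ?c (Suc t) - \<gamma> ^ t * ?c t) sums (0 - start_value S P r \<gamma> \<mu> \<pi>)"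
    by (simp add: start_value_def)
  have "(\<lambda>t. (1 - \<gamma>) * (\<gamma> ^ t * (\<integral>z. r z \<partial>?\<rho> t) + (\<gamma> ^ Suc t * ?c (Suc t) - \<gamma> ^ t * ?c t)))
      sums ((1 - \<gamma>) * (start_value S P r \<gamma> \<mu> \<pi>' + (0 - start_value S P r \<gamma> \<mu> \<pi>)))"
    by (intro sums_mult sums_add rew tele)
  moreover have "(\<lambda>t. (1 - \<gamma>) * \<gamma> ^ t * (\<integral>s. ?g s \<partial>?N t)) sums (\<integral>s. ?g s \<partial>visitation S P \<gamma> \<mu> \<pi>')"
  proof (rule new.integral_visitation)
    show "?g \<in> borel_measurable S" using A_meas by measurable
    show "\<bar>?g s\<bar> \<le> 2 * B" if "s \<in> space S" for s
      using A_bound[OF that] state_value_bound[OF that] by (simp add: B_def)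
  qed
  moreover have "(1 - \<gamma>) * \<gamma> ^ t * (\<integral>s. ?g s \<partial>?N t)
      = (1 - \<gamma>) * (\<gamma> ^ t * (\<integral>z. r z \<partial>?\<rho> t) + (\<gamma> ^ Suc t * ?c (Suc t) - \<gamma> ^ t * ?c t))" for t
    unfolding step by (simp add: algebra_simps)
  ultimately have "(\<integral>s. ?g s \<partial>visitation S P \<gamma> \<mu> \<pi>')
      = (1 - \<gamma>) * (start_value S P r \<gamma> \<mu> \<pi>' - start_value S P r \<gamma> \<mu> \<pi>)"
    by (simp add: sums_unique2)
  moreover have "(\<integral>s. (\<Sum>a\<in>UNIV. (\<pi>' s $ a - \<pi> s $ a) * Q (s, a)) \<partial>visitation S P \<gamma> \<mu> \<pi>')
      = (\<integral>s. ?g s \<partial>visitation S P \<gamma> \<mu> \<pi>')"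
  proof (rule Bochner_Integration.integral_cong[OF refl])
    fix s assume "s \<in> space (visitation S P \<gamma> \<mu> \<pi>')"
    then have "s \<in> space S"
      using new.visitation_closed by (auto simp: space_prob_algebra dest: sets_eq_imp_space_eq)
    then show "(\<Sum>a\<in>UNIV. (\<pi>' s $ a - \<pi> s $ a) * Q (s, a)) = ?g s"
      by (simp add: new.integral_action_kernel state_value_sum left_diff_distrib sum_subtractf)
  qed
  ultimately show ?thesis by simp
qed

section \<open>One step of approximate mirror descent\<close>

lemma measurable_action_component:
  fixes k :: "'s \<Rightarrow> real ^ 'a::finite"
  assumes [measurable]: "k \<in> borel_measurable S"
  shows "(\<lambda>z. k (fst z) $ snd z) \<in> borel_measurable (state_action S)"
proof (rule measurable_compose_countable'[of UNIV "\<lambda>a z. k (fst z) $ a"])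
  show "(\<lambda>z. k (fst z) $ a) \<in> borel_measurable (state_action S)" for a
    unfolding cart_eq_inner_axis by measurable
qed (simp_all add: countable_finite)

lemma ennreal_power2_le_imp_le:
  assumes "x\<^sup>2 \<le> (ennreal c)\<^sup>2" "0 \<le> c"
  shows "x \<le> ennreal c"
proof (cases x)
  case (real y)
  then show ?thesis using assms by (simp add: ennreal_power power_mono_iff)
next
  case top
  then show ?thesis using assms by (simp add: ennreal_power) (simp add: power2_eq_square top_unique)
qed

text \<open>Both sides integrate against the density \<open>p s * \<rho> s $ a\<close> over the
  reference measure times counting measure. Nonnegative integrals are used, so the identity makes no
  integrability demand on \<open>e\<close>.\<close>

lemma density_ratio_change_of_measure:
  fixes \<rho> :: "'s \<Rightarrow> real ^ 'a::finite"
  assumes ratio: "density_ratio S d \<rho> v w" and \<rho>: "policy S \<rho>"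
    and e: "e \<in> borel_measurable (state_action S)"
  shows "w \<in> borel_measurable v"
    and "\<And>z. z \<in> space v \<Longrightarrow> 0 \<le> w z"
    and "sets v = sets (state_action S)"
    and "(\<integral>\<^sup>+s. (\<Sum>a\<in>UNIV. ennreal (\<rho> s $ a * \<bar>e (s, a)\<bar>)) \<partial>d)
      = (\<integral>\<^sup>+z. ennreal (w z) * ennreal \<bar>e z\<bar> \<partial>v)"
proof -
  obtain \<nu> p q where sets: "sets \<nu> = sets S"
    and p[measurable]: "p \<in> borel_measurable \<nu>" and p_nonneg: "\<And>s. s \<in> space \<nu> \<Longrightarrow> 0 \<le> p s"
    and d: "d = density \<nu> (\<lambda>s. ennreal (p s))"
    and q[measurable]: "q \<in> borel_measurable (state_action \<nu>)"
    and q_nonneg: "\<And>z. z \<in> space (state_action \<nu>) \<Longrightarrow> 0 \<le> q z"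
    and v: "v = density (state_action \<nu>) (\<lambda>z. ennreal (q z))"
    and dom: "\<And>s a. s \<in> space \<nu> \<Longrightarrow> 0 < p s * \<rho> s $ a \<Longrightarrow> 0 < q (s, a)"
    and w: "w = (\<lambda>(s, a). p s * \<rho> s $ a / q (s, a))"
    using ratio unfolding density_ratio_def by blast
  have sets2: "sets (state_action \<nu>) = sets (state_action S :: ('s \<times> 'a) measure)"
    by (rule sets_pair_measure_cong[OF sets refl])
  note space = sets_eq_imp_space_eq[OF sets]
  have \<rho>_meas: "\<rho> \<in> borel_measurable \<nu>"
    using \<rho> by (simp add: policy_def measurable_cong_sets[OF sets refl])
  have [measurable]: "(\<lambda>s. \<rho> s $ a) \<in> borel_measurable \<nu>" for a
    using \<rho>_meas unfolding cart_eq_inner_axis by measurable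
  have \<rho>_nonneg: "0 \<le> \<rho> s $ a" if "s \<in> space \<nu>" for s a
    using \<rho> that by (simp add: policy_def prob_simplex_def space)
  have [measurable]: "e \<in> borel_measurable (state_action \<nu>)"
    using e by (simp add: measurable_cong_sets[OF sets2 refl])
  have w_meas[measurable]: "w \<in> borel_measurable (state_action \<nu>)"
    using measurable_action_component[OF \<rho>_meas] unfolding w by (simp add: case_prod_beta')
  then show "w \<in> borel_measurable v" by (simp add: v)
  show "sets v = sets (state_action S)" by (simp add: v sets2)
  show "0 \<le> w z" if "z \<in> space v" for z
    using that p_nonneg \<rho>_nonneg q_nonneg unfolding v w by (auto simp: space_pair_measure)
  interpret count: sigma_finite_measure "count_space (UNIV :: 'a set)"
    by (rule sigma_finite_measure_count_space_finite) simp
  have eq: "ennreal (q (s, a)) * (ennreal (w (s, a)) * ennreal \<bar>e (s, a)\<bar>)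
      = ennreal (p s) * ennreal (\<rho> s $ a * \<bar>e (s, a)\<bar>)" if s: "s \<in> space \<nu>" for s a
  \<comment> \<open>A vanishing numerator makes both sides 0, whatever the quotient does at
    \<open>q (s, a) = 0\<close>. Otherwise the domination condition gives a positive denominator
    that cancels.\<close>
  proof (cases "p s * \<rho> s $ a = 0")
    case True
    then show ?thesis by (auto simp: w)
  next
    case False
    then have "0 < q (s, a)"
      using dom[OF s, of a] p_nonneg[OF s] \<rho>_nonneg[OF s, of a] by (simp add: less_le)
    then show ?thesis
      using p_nonneg[OF s] \<rho>_nonneg[OF s, of a]
      by (simp add: w ennreal_mult[symmetric] del: ennreal_mult')
  qed
  have "(\<integral>\<^sup>+z. ennreal (w z) * ennreal \<bar>e z\<bar> \<partial>v)
      = (\<integral>\<^sup>+z. ennreal (q z) * (ennreal (w z) * ennreal \<bar>e z\<bar>) \<partial>state_action \<nu>)"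
    unfolding v by (subst nn_integral_density) auto
  also have "\<dots> = (\<integral>\<^sup>+s. (\<integral>\<^sup>+a. ennreal (q (s, a)) * (ennreal (w (s, a)) * ennreal \<bar>e (s, a)\<bar>)
      \<partial>count_space UNIV) \<partial>\<nu>)"
    by (subst count.nn_integral_fst[symmetric]) auto
  also have "\<dots> = (\<integral>\<^sup>+s. ennreal (p s) * (\<Sum>a\<in>UNIV. ennreal (\<rho> s $ a * \<bar>e (s, a)\<bar>)) \<partial>\<nu>)"
    by (rule nn_integral_cong) (simp add: nn_integral_count_space_finite eq sum_distrib_left)
  also have "\<dots> = (\<integral>\<^sup>+s. (\<Sum>a\<in>UNIV. ennreal (\<rho> s $ a * \<bar>e (s, a)\<bar>)) \<partial>d)"
    unfolding d by (subst nn_integral_density) auto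
  finally show "(\<integral>\<^sup>+s. (\<Sum>a\<in>UNIV. ennreal (\<rho> s $ a * \<bar>e (s, a)\<bar>)) \<partial>d)
      = (\<integral>\<^sup>+z. ennreal (w z) * ennreal \<bar>e z\<bar> \<partial>v)" ..
qed

text \<open>Cauchy-Schwarz in L_2(v): one factor is the second moment of the ratio from (A2), the
  other the regression error from (A1).\<close>

lemma density_ratio_error_bound:
  fixes \<rho> :: "'s \<Rightarrow> real ^ 'a::finite"
  assumes ratio: "density_ratio S d \<rho> v w" and \<rho>: "policy S \<rho>"
    and e: "e \<in> borel_measurable (state_action S)"
    and C: "0 \<le> C" "(\<integral>\<^sup>+z. ennreal ((w z)\<^sup>2) \<partial>v) \<le> ennreal C"
    and l: "0 \<le> l" "L2_norm_sq v e \<le> ennreal l"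
  shows "(\<integral>\<^sup>+s. (\<Sum>a\<in>UNIV. ennreal (\<rho> s $ a * \<bar>e (s, a)\<bar>)) \<partial>d) \<le> ennreal (sqrt (C * l))"
proof -
  note change = density_ratio_change_of_measure[OF ratio \<rho> e]
  let ?I = "\<integral>\<^sup>+s. (\<Sum>a\<in>UNIV. ennreal (\<rho> s $ a * \<bar>e (s, a)\<bar>)) \<partial>d"
  have e': "e \<in> borel_measurable v"
    using e by (simp add: measurable_cong_sets[OF change(3) refl])
  have "?I\<^sup>2 \<le> (\<integral>\<^sup>+z. (ennreal (w z))\<^sup>2 \<partial>v) * (\<integral>\<^sup>+z. (ennreal \<bar>e z\<bar>)\<^sup>2 \<partial>v)"
    unfolding change(4) using change(1) e' by (intro Cauchy_Schwarz_nn_integral) auto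
  also have "(\<integral>\<^sup>+z. (ennreal (w z))\<^sup>2 \<partial>v) = (\<integral>\<^sup>+z. ennreal ((w z)\<^sup>2) \<partial>v)"
    by (rule nn_integral_cong) (simp add: ennreal_power change(2))
  also have "(\<integral>\<^sup>+z. (ennreal \<bar>e z\<bar>)\<^sup>2 \<partial>v) = L2_norm_sq v e"
    unfolding L2_norm_sq_def by (rule nn_integral_cong) (simp add: ennreal_power)
  also have "(\<integral>\<^sup>+z. ennreal ((w z)\<^sup>2) \<partial>v) * L2_norm_sq v e \<le> ennreal C * ennreal l"
    by (rule mult_mono[OF C(2) l(2)]) auto
  also have "\<dots> = (ennreal (sqrt (C * l)))\<^sup>2"
    using C(1) l(1) by (simp add: ennreal_mult ennreal_power)
  finally show ?thesis
    using C(1) l(1) by (intro ennreal_power2_le_imp_le) auto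
qed

text \<open>\<open>grad h\<close> is continuous only on the interior. Cut off to 0 outside this open
  set it is Borel on the whole space, and the policy never sees the difference.\<close>

lemma (in mirror_map) measurable_grad_policy:
  assumes \<pi>: "policy S \<pi>" "\<And>s. s \<in> space S \<Longrightarrow> \<pi> s \<in> interior Y"
  shows "(\<lambda>s. grad h (\<pi> s)) \<in> borel_measurable S"
proof -
  have "(\<lambda>x. indicator (interior Y) x *\<^sub>R grad h x) \<in> borel_measurable borel"
    by (rule borel_measurable_continuous_on_indicator[OF _ gradient_continuous]) simp
  moreover have "\<pi> \<in> borel_measurable S" using \<pi>(1) by (simp add: policy_def)
  ultimately have "(\<lambda>s. indicator (interior Y) (\<pi> s) *\<^sub>R grad h (\<pi> s)) \<in> borel_measurable S"
    by (rule measurable_compose[rotated])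
  then show ?thesis
    by (subst measurable_cong[where g = "\<lambda>s. indicator (interior Y) (\<pi> s) *\<^sub>R grad h (\<pi> s)"])
       (simp_all add: \<pi>(2))
qed

lemma vec_lambda_measurable:
  fixes g :: "'s \<Rightarrow> 'a::finite \<Rightarrow> real"
  assumes "\<And>a. (\<lambda>s. g s a) \<in> borel_measurable M"
  shows "(\<lambda>s. \<chi> a. g s a) \<in> borel_measurable M"
  using assms by (subst borel_measurable_euclidean_space)
    (auto simp: Basis_vec_def inner_axis)

lemma (in mirror_map) policy_mirror_step:
  fixes g :: "'s \<times> 'a \<Rightarrow> real"
  assumes g: "g \<in> borel_measurable (state_action S)"
    and \<pi>': "\<And>s. s \<in> space S \<Longrightarrow> \<pi>' s = mirror_step (\<eta> *\<^sub>R (\<chi> a. g (s, a)))"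
  shows "policy S \<pi>'"
proof -
  have "(\<lambda>s. g (s, a)) \<in> borel_measurable S" for a
    using g by measurable
  then have "(\<lambda>s. \<eta> *\<^sub>R (\<chi> a. g (s, a))) \<in> borel_measurable S"
    by (intro borel_measurable_scaleR vec_lambda_measurable) auto
  then have "(\<lambda>s. mirror_step (\<eta> *\<^sub>R (\<chi> a. g (s, a)))) \<in> borel_measurable S"
    by (rule measurable_compose[OF _ borel_measurable_continuous_onI[OF continuous_mirror_step]])
  then show ?thesis
    unfolding policy_def using \<pi>' mirror_step_in_simplex by (auto cong: measurable_cong)
qed

section \<open>A single AMPO update with the randomness fixed\<close>

locale mirror_update =
  mirror_map Y h + old: mdp_policy S P r \<gamma> \<mu> \<pi>
  for Y :: "(real ^ 'a::finite) set" and h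
    and S :: "'s measure" and P :: "'s \<times> 'a \<Rightarrow> 's measure" and r \<gamma> \<mu> \<pi> +
  fixes \<pi>' :: "'s \<Rightarrow> real ^ 'a" and g :: "'s \<times> 'a \<Rightarrow> real" and \<eta> :: real
  assumes step_size: "0 < \<eta>"
    and old_interior: "s \<in> space S \<Longrightarrow> \<pi> s \<in> interior Y"
    and approximation_measurable: "g \<in> borel_measurable (state_action S)"
    and update: "s \<in> space S \<Longrightarrow> \<pi>' s = mirror_step (\<eta> *\<^sub>R (\<chi> a. g (s, a)))"
begin

lemma new_policy: "policy S \<pi>'"
  by (rule policy_mirror_step[OF approximation_measurable update])

lemma new_interior: "s \<in> space S \<Longrightarrow> \<pi>' s \<in> interior Y"
  using update mirror_step_interior[OF old.policy_in_simplex old_interior] by simp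

sublocale new: mdp_policy S P r \<gamma> \<mu> \<pi>'
  by unfold_locales (rule new_policy)

definition err :: "'s \<times> 'a \<Rightarrow> real" where
  "err = (\<lambda>(s, a). g (s, a) - action_value S P r \<gamma> \<pi> (s, a) - inverse \<eta> * grad h (\<pi> s) $ a)"

definition gap :: "'s \<Rightarrow> real" where
  "gap s = (bregman h (\<pi>' s) (\<pi> s) + bregman h (\<pi> s) (\<pi>' s)) / (\<eta> * (1 - \<gamma>))"

abbreviation "d \<equiv> visitation S P \<gamma> \<mu> \<pi>'"

lemma err_measurable: "err \<in> borel_measurable (state_action S)"
proof -
  have "(\<lambda>z. grad h (\<pi> (fst z)) $ snd z) \<in> borel_measurable (state_action S)"
    by (rule measurable_action_component[OF measurable_grad_policy[OF old.policy old_interior]])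
  then show ?thesis
    unfolding err_def using approximation_measurable old.action_value_measurable
    by (simp add: case_prod_beta')
qed

lemma gap_eq:
  "gap s = (grad h (\<pi>' s) - grad h (\<pi> s)) \<bullet> (\<pi>' s - \<pi> s) / (\<eta> * (1 - \<gamma>))"
  by (simp add: gap_def bregman_symmetrized)

lemma gap_measurable: "gap \<in> borel_measurable S"
proof -
  note [measurable] = measurable_grad_policy[OF old.policy old_interior]
    measurable_grad_policy[OF new_policy new_interior]
  show ?thesis
    unfolding gap_eq[abs_def] by measurable
qed

lemma gap_nonneg: "s \<in> space S \<Longrightarrow> 0 \<le> gap s"
  unfolding gap_eq using step_size old.discount
  by (intro divide_nonneg_nonneg grad_monotone new_interior old_interior) auto

text \<open>In the variational inequality the dual point minus \<open>grad h (\<pi> s)\<close>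
  equals \<eta> times \<open>Q\<close> plus \<open>err\<close>, so the step size cancels. The error
  against the difference of the policies is split into one sum per policy, because each sum is an
  expectation that (A2) controls by its own density ratio.\<close>

lemma gap_le:
  assumes s: "s \<in> space S"
  shows "(1 - \<gamma>) * gap s \<le>
    (\<Sum>a\<in>UNIV. (\<pi>' s $ a - \<pi> s $ a) * action_value S P r \<gamma> \<pi> (s, a))
    + (\<Sum>a\<in>UNIV. \<pi>' s $ a * \<bar>err (s, a)\<bar>) + (\<Sum>a\<in>UNIV. \<pi> s $ a * \<bar>err (s, a)\<bar>)"
proof -
  let ?y = "\<eta> *\<^sub>R (\<chi> a. g (s, a))" and ?Q = "action_value S P r \<gamma> \<pi>"
  have "0 \<le> (grad h (\<pi>' s) - ?y) \<bullet> (\<pi> s - \<pi>' s)"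
    using mirror_step_variational[of ?y "\<pi> s"] new_interior[OF s] update[OF s]
      old.policy_in_simplex[OF s] by simp
  then have "(grad h (\<pi>' s) - grad h (\<pi> s)) \<bullet> (\<pi>' s - \<pi> s) \<le> (?y - grad h (\<pi> s)) \<bullet> (\<pi>' s - \<pi> s)"
    by (simp add: inner_diff_left inner_diff_right)
  also have "?y - grad h (\<pi> s) = \<eta> *\<^sub>R (\<chi> a. ?Q (s, a) + err (s, a))"
    using step_size by (simp add: vec_eq_iff err_def field_simps)
  finally have "(grad h (\<pi>' s) - grad h (\<pi> s)) \<bullet> (\<pi>' s - \<pi> s)
      \<le> \<eta> * ((\<chi> a. ?Q (s, a) + err (s, a)) \<bullet> (\<pi>' s - \<pi> s))" by simp
  moreover have "(1 - \<gamma>) * gap s = (grad h (\<pi>' s) - grad h (\<pi> s)) \<bullet> (\<pi>' s - \<pi> s) / \<eta>"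
    using old.discount by (simp add: gap_eq)
  ultimately have "(1 - \<gamma>) * gap s \<le> (\<chi> a. ?Q (s, a) + err (s, a)) \<bullet> (\<pi>' s - \<pi> s)"
    using step_size by (simp add: divide_le_eq mult.commute)
  also have "\<dots> = (\<Sum>a\<in>UNIV. (\<pi>' s $ a - \<pi> s $ a) * ?Q (s, a))
      + (\<Sum>a\<in>UNIV. \<pi>' s $ a * err (s, a)) + (\<Sum>a\<in>UNIV. \<pi> s $ a * - err (s, a))"
    by (simp add: inner_vec_def sum.distrib[symmetric] algebra_simps)
  also have "\<dots> \<le> (\<Sum>a\<in>UNIV. (\<pi>' s $ a - \<pi> s $ a) * ?Q (s, a))
      + (\<Sum>a\<in>UNIV. \<pi>' s $ a * \<bar>err (s, a)\<bar>) + (\<Sum>a\<in>UNIV. \<pi> s $ a * \<bar>err (s, a)\<bar>)"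
    using s by (intro add_mono order_refl sum_mono mult_left_mono new.policy_nonneg old.policy_nonneg) auto
  finally show ?thesis .
qed

lemma averaged_error:
  assumes \<rho>: "policy S \<rho>" and ratio: "density_ratio S d \<rho> v w"
    and C: "0 \<le> C" "(\<integral>\<^sup>+z. ennreal ((w z)\<^sup>2) \<partial>v) \<le> ennreal C"
    and l: "0 \<le> l" "L2_norm_sq v err \<le> ennreal l"
  shows "integrable d (\<lambda>s. \<Sum>a\<in>UNIV. \<rho> s $ a * \<bar>err (s, a)\<bar>)"
    and "(\<integral>s. (\<Sum>a\<in>UNIV. \<rho> s $ a * \<bar>err (s, a)\<bar>) \<partial>d) \<le> sqrt (C * l)"
proof -
  interpret \<rho>: mdp_policy S P r \<gamma> \<mu> \<rho> by unfold_locales (rule \<rho>)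
  let ?X = "\<lambda>s. \<Sum>a\<in>UNIV. \<rho> s $ a * \<bar>err (s, a)\<bar>"
  have d: "sets d = sets S" using new.visitation_closed by (simp add: space_prob_algebra)
  note [measurable] = err_measurable
  have "?X \<in> borel_measurable S" by measurable
  then have meas: "?X \<in> borel_measurable d" by (simp add: measurable_cong_sets[OF d refl])
  have nonneg: "0 \<le> ?X s" if "s \<in> space d" for s
    using that sets_eq_imp_space_eq[OF d] by (intro sum_nonneg mult_nonneg_nonneg) (auto simp: \<rho>.policy_nonneg)
  have "(\<integral>\<^sup>+s. ennreal (?X s) \<partial>d) = (\<integral>\<^sup>+s. (\<Sum>a\<in>UNIV. ennreal (\<rho> s $ a * \<bar>err (s, a)\<bar>)) \<partial>d)"
    by (rule nn_integral_cong) (simp add: sum_ennreal \<rho>.policy_nonneg sets_eq_imp_space_eq[OF d])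
  also have "\<dots> \<le> ennreal (sqrt (C * l))"
    by (rule density_ratio_error_bound[OF ratio \<rho> err_measurable C l])
  finally have bound: "(\<integral>\<^sup>+s. ennreal (?X s) \<partial>d) \<le> ennreal (sqrt (C * l))" .
  show int: "integrable d ?X"
    using meas nonneg le_less_trans[OF bound] by (intro integrableI_nonneg AE_I2) auto
  show "(\<integral>s. ?X s \<partial>d) \<le> sqrt (C * l)"
    using bound nn_integral_eq_integral[OF int] nonneg C l by (simp add: AE_I2)
qed

text \<open>\<open>gap_le\<close> is integrated over \<open>d\<close>: the \<open>Q\<close> part is
  the performance difference and each error sum costs at most \<open>sqrt (C * l)\<close>. Since
  \<open>gap\<close> is nonnegative, the same inequality makes the integrable right-hand side a
  dominating function for it.\<close>

lemma value_improvement: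
  assumes ratio': "density_ratio S d \<pi>' v w'" "(\<integral>\<^sup>+z. ennreal ((w' z)\<^sup>2) \<partial>v) \<le> ennreal C"
    and ratio: "density_ratio S d \<pi> v w" "(\<integral>\<^sup>+z. ennreal ((w z)\<^sup>2) \<partial>v) \<le> ennreal C"
    and C: "0 \<le> C" and l: "0 \<le> l" "L2_norm_sq v err \<le> ennreal l"
  shows "integrable d gap"
    and "0 \<le> (\<integral>s. gap s \<partial>d)"
    and "(\<integral>s. gap s \<partial>d) \<le> start_value S P r \<gamma> \<mu> \<pi>' - start_value S P r \<gamma> \<mu> \<pi>
      + 2 * sqrt (C * l) / (1 - \<gamma>)"
proof -
  let ?G = "\<lambda>s. \<Sum>a\<in>UNIV. (\<pi>' s $ a - \<pi> s $ a) * action_value S P r \<gamma> \<pi> (s, a)"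
  let ?X = "\<lambda>\<rho> s. \<Sum>a\<in>UNIV. \<rho> s $ a * \<bar>err (s, a)\<bar>"
  note X' = averaged_error[OF new_policy ratio'(1) C ratio'(2) l]
    and X = averaged_error[OF old.policy ratio(1) C ratio(2) l]
  have d: "sets d = sets S" using new.visitation_closed by (simp add: space_prob_algebra)
  have G_meas: "?G \<in> borel_measurable S" by measurable
  have G_bound: "\<bar>?G s\<bar> \<le> (\<Sum>a\<in>(UNIV :: 'a set). 1 / (1 - \<gamma>))" if s: "s \<in> space S" for s
  proof (rule order_trans[OF sum_abs sum_mono])
    fix a
    have "\<bar>\<pi>' s $ a - \<pi> s $ a\<bar> \<le> 1"
      using prob_simplex_le_1[OF new.policy_in_simplex[OF s], of a] new.policy_nonneg[OF s, of a]
        prob_simplex_le_1[OF old.policy_in_simplex[OF s], of a] old.policy_nonneg[OF s, of a] by auto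
    moreover have "\<bar>action_value S P r \<gamma> \<pi> (s, a)\<bar> \<le> 1 / (1 - \<gamma>)"
      using s by (intro old.action_value_bound) (simp add: space_pair_measure)
    ultimately show "\<bar>(\<pi>' s $ a - \<pi> s $ a) * action_value S P r \<gamma> \<pi> (s, a)\<bar> \<le> 1 / (1 - \<gamma>)"
      unfolding abs_mult using mult_mono[of _ 1 _ "1 / (1 - \<gamma>)"] by fastforce
  qed
  have G: "integrable d ?G"
    by (rule prob_integrable_bounded[OF new.visitation_closed G_meas G_bound])
  have sum: "integrable d (\<lambda>s. ?G s + ?X \<pi>' s + ?X \<pi> s)"
    using G X'(1) X(1) by simp
  have "integrable d (\<lambda>s. (1 - \<gamma>) * gap s)"
  proof (rule Bochner_Integration.integrable_bound[OF sum])
    show "(\<lambda>s. (1 - \<gamma>) * gap s) \<in> borel_measurable d"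
      using gap_measurable by (simp add: measurable_cong_sets[OF d refl])
    show "AE s in d. norm ((1 - \<gamma>) * gap s) \<le> norm (?G s + ?X \<pi>' s + ?X \<pi> s)"
    proof (rule AE_I2)
      fix s assume "s \<in> space d"
      then have s: "s \<in> space S" by (simp add: sets_eq_imp_space_eq[OF d])
      then have "0 \<le> (1 - \<gamma>) * gap s" using gap_nonneg old.discount by simp
      with gap_le[OF s] show "norm ((1 - \<gamma>) * gap s) \<le> norm (?G s + ?X \<pi>' s + ?X \<pi> s)" by simp
    qed
  qed
  then show int: "integrable d gap"
    using old.discount by simp
  show "0 \<le> (\<integral>s. gap s \<partial>d)"
    by (rule Bochner_Integration.integral_nonneg) (simp add: gap_nonneg sets_eq_imp_space_eq[OF d])
  have "(1 - \<gamma>) * (\<integral>s. gap s \<partial>d) = (\<integral>s. (1 - \<gamma>) * gap s \<partial>d)" by simp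
  also have "\<dots> \<le> (\<integral>s. ?G s + ?X \<pi>' s + ?X \<pi> s \<partial>d)"
    using int by (intro Bochner_Integration.integral_mono sum gap_le) (auto simp: sets_eq_imp_space_eq[OF d])
  also have "\<dots> = (\<integral>s. ?G s \<partial>d) + (\<integral>s. ?X \<pi>' s \<partial>d) + (\<integral>s. ?X \<pi> s \<partial>d)"
    using G X'(1) X(1) by simp
  also have "\<dots> \<le> (1 - \<gamma>) * (start_value S P r \<gamma> \<mu> \<pi>' - start_value S P r \<gamma> \<mu> \<pi>) + 2 * sqrt (C * l)"
    using old.performance_difference[OF new_policy] X'(2) X(2) by simp
  finally show "(\<integral>s. gap s \<partial>d) \<le> start_value S P r \<gamma> \<mu> \<pi>' - start_value S P r \<gamma> \<mu> \<pi>
      + 2 * sqrt (C * l) / (1 - \<gamma>)"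
    using old.discount by (simp add: field_simps)
qed

end

section \<open>Averaging over the randomness of the algorithm\<close>

lemma (in prob_space) expectation_sqrt_le:
  assumes L: "L \<in> borel_measurable M" and bound: "(\<integral>\<^sup>+\<omega>. L \<omega> \<partial>M) \<le> ennreal c" and c: "0 \<le> c"
  shows "integrable M (\<lambda>\<omega>. sqrt (enn2real (L \<omega>)))"
    and "expectation (\<lambda>\<omega>. sqrt (enn2real (L \<omega>))) \<le> sqrt c"
proof -
  let ?s = "\<lambda>\<omega>. sqrt (enn2real (L \<omega>))"
  have s: "?s \<in> borel_measurable M" using L by measurable
  \<comment> \<open>Jensen for the square root in the form of Cauchy-Schwarz against the constant
    1.\<close>
  have "(\<integral>\<^sup>+\<omega>. ennreal (?s \<omega>) \<partial>M)\<^sup>2 = (\<integral>\<^sup>+\<omega>. 1 * ennreal (?s \<omega>) \<partial>M)\<^sup>2" by simp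
  also have "\<dots> \<le> (\<integral>\<^sup>+\<omega>. 1\<^sup>2 \<partial>M) * (\<integral>\<^sup>+\<omega>. (ennreal (?s \<omega>))\<^sup>2 \<partial>M)"
    using s by (intro Cauchy_Schwarz_nn_integral) auto
  also have "\<dots> = (\<integral>\<^sup>+\<omega>. (ennreal (?s \<omega>))\<^sup>2 \<partial>M)"
    by (simp add: emeasure_space_1)
  also have "\<dots> \<le> (\<integral>\<^sup>+\<omega>. L \<omega> \<partial>M)"
  proof (rule nn_integral_mono)
    fix \<omega>
    \<comment> \<open>\<open>enn2real\<close> sends infinity to 0, which is on the safe side here;
      at finite values there is equality.\<close>
    show "(ennreal (?s \<omega>))\<^sup>2 \<le> L \<omega>"
      by (cases "L \<omega>") (simp_all add: ennreal_power)
  qed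
  also have "\<dots> \<le> (ennreal (sqrt c))\<^sup>2"
    using bound c by (simp add: ennreal_power)
  finally have le: "(\<integral>\<^sup>+\<omega>. ennreal (?s \<omega>) \<partial>M) \<le> ennreal (sqrt c)"
    using c by (intro ennreal_power2_le_imp_le) auto
  show int: "integrable M ?s"
    using s le_less_trans[OF le] by (intro integrableI_nonneg AE_I2) auto
  show "expectation ?s \<le> sqrt c"
    using le nn_integral_eq_integral[OF int] c by simp
qed

text \<open>The Bochner integral of a non-integrable function is 0 by convention. The conclusion
  therefore also asserts integrability of the inner integrand for almost every realization and of
  both outer integrands, so that the inequality compares genuine expectations.\<close>

theorem proposition4p2:
  fixes S :: "'s measure"
    and P :: "'s \<times> 'a::finite \<Rightarrow> 's measure"
    and r :: "'s \<times> 'a \<Rightarrow> real"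
    and \<gamma> :: real
    and \<mu> :: "'s measure"
    and Y :: "(real ^ 'a) set"
    and h :: "real ^ 'a \<Rightarrow> real"
    and \<Theta> :: "'p set"
    and f :: "'p \<Rightarrow> 's \<times> 'a \<Rightarrow> real"
    and \<Omega> :: "'w measure"
    and \<eta> :: "nat \<Rightarrow> real"
    and v :: "nat \<Rightarrow> 'w \<Rightarrow> ('s \<times> 'a) measure"
    and \<theta> :: "nat \<Rightarrow> 'w \<Rightarrow> 'p"
    and \<pi>\<^sub>0 \<pi>\<^sub>o :: "'s \<Rightarrow> real ^ 'a"
    and \<pi> :: "nat \<Rightarrow> 'w \<Rightarrow> 's \<Rightarrow> real ^ 'a"
    and \<epsilon> C\<^sub>v :: real
  assumes mdp: "mdp S P r \<gamma> \<mu>"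
    and optimal: "optimal_policy S P r \<gamma> \<mu> \<pi>\<^sub>o"
    and mirror: "mirror_map Y h"
    and param_class: "\<And>p. p \<in> \<Theta> \<Longrightarrow> f p \<in> borel_measurable (state_action S)"
    and randomness: "prob_space \<Omega>"
    and step_size: "\<And>t. 0 < \<eta> t"
    and v_distr: "\<And>t \<omega>. \<omega> \<in> space \<Omega> \<Longrightarrow> v t \<omega> \<in> space (prob_algebra (state_action S))"
    and initial_policy: "policy S \<pi>\<^sub>0" "\<And>s. s \<in> space S \<Longrightarrow> \<pi>\<^sub>0 s \<in> interior Y"
    and AMPO_init: "\<And>\<omega> s. \<omega> \<in> space \<Omega> \<Longrightarrow> s \<in> space S \<Longrightarrow> \<pi> 0 \<omega> s = \<pi>\<^sub>0 s"
    and AMPO_param: "\<And>t \<omega>. \<omega> \<in> space \<Omega> \<Longrightarrow> \<theta> (Suc t) \<omega> \<in> \<Theta>"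
    and AMPO_update: "\<And>t \<omega> s. \<omega> \<in> space \<Omega> \<Longrightarrow> s \<in> space S \<Longrightarrow>
      \<pi> (Suc t) \<omega> s =
        bregman_proj h (grad (conjugate Y h) (\<eta> t *\<^sub>R (\<chi> a. f (\<theta> (Suc t) \<omega>) (s, a))))"
    and constants: "0 \<le> \<epsilon>" "0 \<le> C\<^sub>v"
    and well_defined_error: "\<And>t.
      (\<lambda>\<omega>. L2_norm_sq (v t \<omega>) (\<lambda>(s, a).
         f (\<theta> (Suc t) \<omega>) (s, a) - action_value S P r \<gamma> (\<pi> t \<omega>) (s, a)
           - inverse (\<eta> t) * grad h (\<pi> t \<omega> s) $ a))
      \<in> borel_measurable \<Omega>"
    and well_defined_value: "\<And>t.
      (\<lambda>\<omega>. start_value S P r \<gamma> \<mu> (\<pi> (Suc t) \<omega>) - start_value S P r \<gamma> \<mu> (\<pi> t \<omega>))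
      \<in> borel_measurable \<Omega>"
    and well_defined_bregman: "\<And>t.
      (\<lambda>\<omega>. \<integral>s. (bregman h (\<pi> (Suc t) \<omega> s) (\<pi> t \<omega> s) + bregman h (\<pi> t \<omega> s) (\<pi> (Suc t) \<omega> s))
                  / (\<eta> t * (1 - \<gamma>)) \<partial>visitation S P \<gamma> \<mu> (\<pi> (Suc t) \<omega>))
      \<in> borel_measurable \<Omega>"
    and A1: "\<And>t.
      (\<integral>\<^sup>+\<omega>. L2_norm_sq (v t \<omega>) (\<lambda>(s, a).
         f (\<theta> (Suc t) \<omega>) (s, a) - action_value S P r \<gamma> (\<pi> t \<omega>) (s, a)
           - inverse (\<eta> t) * grad h (\<pi> t \<omega> s) $ a) \<partial>\<Omega>)
      \<le> ennreal \<epsilon>"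
    and A2: "\<And>t. AE \<omega> in \<Omega>.
      \<forall>(d, \<rho>) \<in> {(visitation S P \<gamma> \<mu> \<pi>\<^sub>o, \<pi>\<^sub>o),
                  (visitation S P \<gamma> \<mu> (\<pi> (Suc t) \<omega>), \<pi> (Suc t) \<omega>),
                  (visitation S P \<gamma> \<mu> \<pi>\<^sub>o, \<pi> t \<omega>),
                  (visitation S P \<gamma> \<mu> (\<pi> (Suc t) \<omega>), \<pi> t \<omega>)}.
        \<exists>w. density_ratio S d \<rho> (v t \<omega>) w \<and> (\<integral>\<^sup>+z. ennreal ((w z)\<^sup>2) \<partial>v t \<omega>) \<le> ennreal C\<^sub>v"
  shows "\<forall>t.
    (AE \<omega> in \<Omega>. integrable (visitation S P \<gamma> \<mu> (\<pi> (Suc t) \<omega>)) (\<lambda>s.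
       (bregman h (\<pi> (Suc t) \<omega> s) (\<pi> t \<omega> s) + bregman h (\<pi> t \<omega> s) (\<pi> (Suc t) \<omega> s))
         / (\<eta> t * (1 - \<gamma>)))) \<and>
    integrable \<Omega> (\<lambda>\<omega>. \<integral>s.
       (bregman h (\<pi> (Suc t) \<omega> s) (\<pi> t \<omega> s) + bregman h (\<pi> t \<omega> s) (\<pi> (Suc t) \<omega> s))
         / (\<eta> t * (1 - \<gamma>)) \<partial>visitation S P \<gamma> \<mu> (\<pi> (Suc t) \<omega>)) \<and>
    integrable \<Omega> (\<lambda>\<omega>.
       start_value S P r \<gamma> \<mu> (\<pi> (Suc t) \<omega>) - start_value S P r \<gamma> \<mu> (\<pi> t \<omega>)) \<and>
    (\<integral>\<omega>. start_value S P r \<gamma> \<mu> (\<pi> (Suc t) \<omega>) - start_value S P r \<gamma> \<mu> (\<pi> t \<omega>) \<partial>\<Omega>)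
      \<ge> (\<integral>\<omega>. (\<integral>s.
           (bregman h (\<pi> (Suc t) \<omega> s) (\<pi> t \<omega> s) + bregman h (\<pi> t \<omega> s) (\<pi> (Suc t) \<omega> s))
             / (\<eta> t * (1 - \<gamma>)) \<partial>visitation S P \<gamma> \<mu> (\<pi> (Suc t) \<omega>)) \<partial>\<Omega>)
        - 2 * sqrt (C\<^sub>v * \<epsilon>) / (1 - \<gamma>)"
proof -
  interpret mdp S P r \<gamma> \<mu> by (rule mdp)
  interpret mirror_map Y h by (rule mirror)
  interpret \<Omega>: prob_space \<Omega> by (rule randomness)
  let ?J = "start_value S P r \<gamma> \<mu>"
  have policies: "policy S (\<pi> t \<omega>) \<and> (\<forall>s\<in>space S. \<pi> t \<omega> s \<in> interior Y)" if \<omega>: "\<omega> \<in> space \<Omega>" for t \<omega>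
  proof (cases t)
    case 0
    have "\<pi> 0 \<omega> \<in> borel_measurable S"
      using initial_policy(1) AMPO_init[OF \<omega>] by (auto simp: policy_def cong: measurable_cong)
    then show ?thesis
      using 0 initial_policy AMPO_init[OF \<omega>] by (simp add: policy_def)
  next
    case (Suc n)
    have update: "\<pi> t \<omega> s = mirror_step (\<eta> n *\<^sub>R (\<chi> a. f (\<theta> (Suc n) \<omega>) (s, a)))" if "s \<in> space S" for s
      using AMPO_update[OF \<omega> that, of n] Suc by (simp add: mirror_step_def)
    have "policy S (\<pi> t \<omega>)"
      by (rule policy_mirror_step[OF param_class[OF AMPO_param[OF \<omega>]] update])
    moreover have "\<pi> t \<omega> s \<in> interior Y" if s: "s \<in> space S" for s
      unfolding update[OF s] using initial_policy s
      \<comment> \<open>The initial policy serves as the interior simplex point at every iteration,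
        so a case distinction on \<open>t\<close> replaces an induction.\<close>
      by (intro mirror_step_interior[of "\<pi>\<^sub>0 s"]) (auto simp: policy_def)
    ultimately show ?thesis by blast
  qed
  show ?thesis
  proof (rule allI)
    fix t
    let ?err = "\<lambda>\<omega> (s, a). f (\<theta> (Suc t) \<omega>) (s, a) - action_value S P r \<gamma> (\<pi> t \<omega>) (s, a)
      - inverse (\<eta> t) * grad h (\<pi> t \<omega> s) $ a"
    let ?D = "\<lambda>\<omega> s. (bregman h (\<pi> (Suc t) \<omega> s) (\<pi> t \<omega> s) + bregman h (\<pi> t \<omega> s) (\<pi> (Suc t) \<omega> s))
      / (\<eta> t * (1 - \<gamma>))"
    let ?d = "\<lambda>\<omega>. visitation S P \<gamma> \<mu> (\<pi> (Suc t) \<omega>)"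
    define I where "I \<omega> = (\<integral>s. ?D \<omega> s \<partial>?d \<omega>)" for \<omega>
    define \<Delta> where "\<Delta> \<omega> = ?J (\<pi> (Suc t) \<omega>) - ?J (\<pi> t \<omega>)" for \<omega>
    define L where "L \<omega> = L2_norm_sq (v t \<omega>) (?err \<omega>)" for \<omega>
    \<comment> \<open>The error allowance of one realization. Its random part is isolated as a
      square root, whose mean is at most \<open>sqrt \<epsilon>\<close>.\<close>
    define R where "R \<omega> = 2 * sqrt C\<^sub>v / (1 - \<gamma>) * sqrt (enn2real (L \<omega>))" for \<omega>
    have L_meas: "L \<in> borel_measurable \<Omega>"
      unfolding L_def by (rule well_defined_error)
    have L_int: "(\<integral>\<^sup>+\<omega>. L \<omega> \<partial>\<Omega>) \<le> ennreal \<epsilon>"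
      unfolding L_def by (rule A1)
    note sqrt_L = \<Omega>.expectation_sqrt_le[OF L_meas L_int constants(1)]
    have R_int: "integrable \<Omega> R"
      unfolding R_def using sqrt_L(1) by simp
    have "(\<integral>\<omega>. R \<omega> \<partial>\<Omega>) = 2 * sqrt C\<^sub>v / (1 - \<gamma>) * (\<integral>\<omega>. sqrt (enn2real (L \<omega>)) \<partial>\<Omega>)"
      unfolding R_def by simp
    also have "\<dots> \<le> 2 * sqrt C\<^sub>v / (1 - \<gamma>) * sqrt \<epsilon>"
      using sqrt_L(2) constants discount by (intro mult_left_mono) auto
    finally have R_le: "(\<integral>\<omega>. R \<omega> \<partial>\<Omega>) \<le> 2 * sqrt (C\<^sub>v * \<epsilon>) / (1 - \<gamma>)"
      by (simp add: real_sqrt_mult)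
    \<comment> \<open>Finiteness almost everywhere, from (A1), is what makes
      \<open>enn2real (L \<omega>)\<close> an actual bound on the error of the realization.\<close>
    have "AE \<omega> in \<Omega>. L \<omega> \<noteq> \<infinity>"
      using L_meas L_int by (intro nn_integral_PInf_AE) (auto simp: top_unique)
    then have step: "AE \<omega> in \<Omega>. integrable (?d \<omega>) (?D \<omega>) \<and> 0 \<le> I \<omega> \<and> I \<omega> \<le> \<Delta> \<omega> + R \<omega>"
      using A2[of t] AE_space
    proof eventually_elim
      case (elim \<omega>)
      then have \<omega>: "\<omega> \<in> space \<Omega>" by simp
      interpret upd: mirror_update Y h S P r \<gamma> \<mu> "\<pi> t \<omega>" "\<pi> (Suc t) \<omega>" "f (\<theta> (Suc t) \<omega>)" "\<eta> t"
      proof unfold_locales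
        show "policy S (\<pi> t \<omega>)"
          using policies[OF \<omega>] by blast
        show "0 < \<eta> t"
          by (rule step_size)
        show "f (\<theta> (Suc t) \<omega>) \<in> borel_measurable (state_action S)"
          by (rule param_class[OF AMPO_param[OF \<omega>]])
        fix s assume s: "s \<in> space S"
        show "\<pi> t \<omega> s \<in> interior Y"
          using policies[OF \<omega>] s by blast
        show "\<pi> (Suc t) \<omega> s = mirror_step (\<eta> t *\<^sub>R (\<chi> a. f (\<theta> (Suc t) \<omega>) (s, a)))"
          unfolding mirror_step_def by (rule AMPO_update[OF \<omega> s])
      qed
      obtain w' where w': "density_ratio S (?d \<omega>) (\<pi> (Suc t) \<omega>) (v t \<omega>) w'"
          "(\<integral>\<^sup>+z. ennreal ((w' z)\<^sup>2) \<partial>v t \<omega>) \<le> ennreal C\<^sub>v"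
        using bspec[OF elim(2), of "(?d \<omega>, \<pi> (Suc t) \<omega>)"] by auto
      obtain w where w: "density_ratio S (?d \<omega>) (\<pi> t \<omega>) (v t \<omega>) w"
          "(\<integral>\<^sup>+z. ennreal ((w z)\<^sup>2) \<partial>v t \<omega>) \<le> ennreal C\<^sub>v"
        using bspec[OF elim(2), of "(?d \<omega>, \<pi> t \<omega>)"] by auto
      have L: "L2_norm_sq (v t \<omega>) upd.err \<le> ennreal (enn2real (L \<omega>))"
        using elim(1) by (simp add: upd.err_def L_def less_top)
      have gap: "upd.gap = ?D \<omega>"
        by (rule ext) (simp add: upd.gap_def)
      show ?case
        using upd.value_improvement[OF w' w constants(2) enn2real_nonneg L]
        unfolding gap I_def \<Delta>_def R_def by (simp add: real_sqrt_mult)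
    qed
    have \<Delta>_int: "integrable \<Omega> \<Delta>"
    proof (rule \<Omega>.integrable_const_bound[where B = "2 / (1 - \<gamma>)"])
      show "\<Delta> \<in> borel_measurable \<Omega>" unfolding \<Delta>_def by (rule well_defined_value)
      have J: "\<bar>?J (\<pi> n \<omega>)\<bar> \<le> 1 / (1 - \<gamma>)" if \<omega>: "\<omega> \<in> space \<Omega>" for n \<omega>
      proof -
        interpret \<pi>: mdp_policy S P r \<gamma> \<mu> "\<pi> n \<omega>"
          using policies[OF \<omega>] by unfold_locales blast
        show ?thesis by (rule \<pi>.start_value_bound)
      qed
      show "AE \<omega> in \<Omega>. norm (\<Delta> \<omega>) \<le> 2 / (1 - \<gamma>)"
      proof (rule AE_I2)
        fix \<omega> assume \<omega>: "\<omega> \<in> space \<Omega>"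
        have "norm (\<Delta> \<omega>) \<le> \<bar>?J (\<pi> (Suc t) \<omega>)\<bar> + \<bar>?J (\<pi> t \<omega>)\<bar>"
          unfolding \<Delta>_def real_norm_def by (rule abs_triangle_ineq4)
        also have "\<dots> \<le> 1 / (1 - \<gamma>) + 1 / (1 - \<gamma>)"
          by (rule add_mono[OF J[OF \<omega>] J[OF \<omega>]])
        finally show "norm (\<Delta> \<omega>) \<le> 2 / (1 - \<gamma>)" by simp
      qed
    qed
    have I_int: "integrable \<Omega> I"
    \<comment> \<open>The realization-wise bounds \<open>0 \<le> I \<omega>\<close> and
      \<open>I \<omega> \<le> \<Delta> \<omega> + R \<omega>\<close> provide the dominating
      function.\<close>
    proof (rule Bochner_Integration.integrable_bound)
      show "integrable \<Omega> (\<lambda>\<omega>. \<Delta> \<omega> + R \<omega>)" using \<Delta>_int R_int by simp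
      show "I \<in> borel_measurable \<Omega>" unfolding I_def by (rule well_defined_bregman)
      show "AE \<omega> in \<Omega>. norm (I \<omega>) \<le> norm (\<Delta> \<omega> + R \<omega>)"
        using step by eventually_elim auto
    qed
    have "(\<integral>\<omega>. I \<omega> \<partial>\<Omega>) \<le> (\<integral>\<omega>. \<Delta> \<omega> + R \<omega> \<partial>\<Omega>)"
      using I_int \<Delta>_int R_int step by (intro integral_mono_AE) auto
    also have "\<dots> = (\<integral>\<omega>. \<Delta> \<omega> \<partial>\<Omega>) + (\<integral>\<omega>. R \<omega> \<partial>\<Omega>)"
      using \<Delta>_int R_int by simp
    finally have "(\<integral>\<omega>. \<Delta> \<omega> \<partial>\<Omega>) \<ge> (\<integral>\<omega>. I \<omega> \<partial>\<Omega>) - 2 * sqrt (C\<^sub>v * \<epsilon>) / (1 - \<gamma>)"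
      using R_le by linarith
    moreover have "AE \<omega> in \<Omega>. integrable (?d \<omega>) (?D \<omega>)"
      using step by eventually_elim blast
    ultimately show "(AE \<omega> in \<Omega>. integrable (?d \<omega>) (?D \<omega>)) \<and>
        integrable \<Omega> (\<lambda>\<omega>. \<integral>s. ?D \<omega> s \<partial>?d \<omega>) \<and>
        integrable \<Omega> (\<lambda>\<omega>. ?J (\<pi> (Suc t) \<omega>) - ?J (\<pi> t \<omega>)) \<and>
        (\<integral>\<omega>. ?J (\<pi> (Suc t) \<omega>) - ?J (\<pi> t \<omega>) \<partial>\<Omega>)
          \<ge> (\<integral>\<omega>. (\<integral>s. ?D \<omega> s \<partial>?d \<omega>) \<partial>\<Omega>) - 2 * sqrt (C\<^sub>v * \<epsilon>) / (1 - \<gamma>)"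
      using I_int \<Delta>_int unfolding I_def[abs_def] \<Delta>_def[abs_def] by (intro conjI)
  qed
qed

end
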